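(* Let $k\ge 2$ and $n\ge 1$ be integers. A bounded linear operator $\mathcal{S}$ on $L^2(\mathbb{T}^n)$ is a $k^{th}$ order slant Hankel operator of level $n$ if and only if $\mathcal{S}$ can be represented (with respect to the orthonormal basis $\{e_m\}_{m\in\mathbb{Z}^n}$) as a $k^{th}$ order slant Hankel matrix of level $n$.
   Context: $\mathbb{T}^n$ is the $n$-torus with normalized Haar measure; $e_m(z)=z^m=z_1^{m_1}\cdots z_n^{m_n}$ for $m=(m_1,\dots,m_n)\in\mathbb{Z}^n$, an orthonormal basis of $L^2(\mathbb{T}^n)$. For $m\in\mathbb{Z}^n$, $k\mid m$ means $k$ divides every component of $m$. Let $\mathcal{V}_k^n$ be the bounded linear operator on $L^2(\mathbb{T}^n)$ with $\mathcal{V}_k^n e_m=e_{-m/k}$ if $k\mid m$ and $\mathcal{V}_k^n e_m=0$ otherwise. For $\phi\in L^\infty(\mathbb{T}^n)$, $M_\phi$ is multiplication by $\phi$ on $L^2(\mathbb{T}^n)$ and $\mathcal{S}_\phi^{k,n}=\mathcal{V}_k^nM_\phi$. A $k^{th}$ order slant Hankel operator (of level $n$) on $L^2(\mathbb{T}^n)$ is an operator of the form $\mathcal{S}_\phi^{k,n}$ for some $\phi\in L^\infty(\mathbb{T}^n)$. A $k^{th}$ order slant Hankel matrix of level $n$ is built recursively from a family of scalars $\{a_m\}_{m\in\mathbb{Z}^n}$: for fixed $m_2,\dots,m_n$, the level $1$ matrix $\mathcal{S}^{k,1}_{m_2,\dots,m_n}$ is the doubly infinite matrix whose entry in row $p$,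 column $q$ ($p,q\in\mathbb{Z}$) is $a_{(-kp-q,\,m_2,\dots,m_n)}$; for $2\le j\le n$, the level $j$ matrix $\mathcal{S}^{k,j}_{m_{j+1},\dots,m_n}$ is the doubly infinite block matrix whose block in row $p$, column $q$ is $\mathcal{S}^{k,j-1}_{-kp-q,\,m_{j+1},\dots,m_n}$. The level $n$ matrix is thus indexed by $\mathbb{Z}^n\times\mathbb{Z}^n$ with entry in row $m'$, column $m$ equal to $a_{-km'-m}$; equivalently, a matrix $(\beta_{m',m})_{m',m\in\mathbb{Z}^n}$ (row $m'$, column $m$) is of this form iff $\beta_{m'+\varepsilon_j,\,m-k\varepsilon_j}=\beta_{m',m}$ for all $m,m'\in\mathbb{Z}^n$, $1\le j\le n$, and in addition... only this invariance is required, where $\varepsilon_j$ is the $j$-th standard unit vector of $\mathbb{Z}^n$. The matrix of $\mathcal{S}$ has entry $\langle \mathcal{S}e_m,e_{m'}\rangle$ in row $m'$, column $m$. *)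

theory Defs
  imports "HOL-Probability.Probability"
begin

section \<open>The torus\<close>

text \<open>Normalized Haar measure of the unit circle, as the image of Lebesgue measure on $[0,1)$
  under $t \mapsto e^{2\pi i t}$; the Haar measure of the torus is its power.\<close>

definition circle :: "complex measure" where
  "circle = distr (restrict_space lborel {0..<1::real})
     (restrict_space borel (sphere 0 1)) (\<lambda>t. cis (2 * pi * t))"

text \<open>The dimension of the torus is \<open>CARD('n)\<close>; its points are the functions
  \<open>z :: 'n \<Rightarrow> complex\<close> all of whose components have modulus 1.\<close>

definition torus :: "('n::finite \<Rightarrow> complex) measure" where
  "torus = PiM UNIV (\<lambda>_. circle)"

lemma prob_space_circle: "prob_space circle"
proof -
  have "prob_space (restrict_space lborel {0..<1::real})"
    by (rule prob_spaceI) (simp add: emeasure_restrict_space)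
  moreover have "(\<lambda>t::real. cis (2 * pi * t)) \<in> borel_measurable borel"
    by (intro borel_measurable_continuous_onI continuous_intros)
  then have "(\<lambda>t. cis (2 * pi * t)) \<in> measurable (restrict_space lborel {0..<1::real})
      (restrict_space borel (sphere 0 1))"
    by (intro measurable_restrict_space3) (auto simp: measurable_lborel1)
  ultimately show ?thesis
    unfolding circle_def by (rule prob_space.prob_space_distr)
qed

lemma prob_space_torus: "prob_space (torus :: ('n::finite \<Rightarrow> complex) measure)"
  unfolding torus_def by (intro prob_space_PiM prob_space_circle)

lemma space_circle: "space circle = sphere 0 1"
  by (simp add: circle_def space_restrict_space)

lemma space_torus: "space torus = {z. \<forall>i. cmod (z i) = 1}"
  by (auto simp: torus_def space_PiM space_circle PiE_def)

lemma measurable_torus_component [measurable]: "(\<lambda>z. z i) \<in> borel_measurable torus"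
proof -
  have "(\<lambda>z. z i) \<in> measurable torus circle"
    unfolding torus_def by simp
  also have "measurable torus circle = measurable torus (restrict_space borel (sphere 0 1))"
    by (intro measurable_cong_sets) (simp_all add: circle_def)
  finally show ?thesis
    by (simp add: measurable_restrict_space2_iff)
qed

section \<open>The Hilbert space $L^2$ of the torus\<close>

definition sq_integrable :: "(('n::finite \<Rightarrow> complex) \<Rightarrow> complex) \<Rightarrow> bool" where
  "sq_integrable f \<longleftrightarrow>
     f \<in> borel_measurable torus \<and> integrable torus (\<lambda>z. (cmod (f z))\<^sup>2)"

lemma sq_integrable_add:
  assumes "sq_integrable f" "sq_integrable g"
  shows "sq_integrable (\<lambda>z. f z + g z)"
proof -
  have [measurable]: "f \<in> borel_measurable torus" "g \<in> borel_measurable torus"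
    using assms by (auto simp: sq_integrable_def)
  have "integrable torus (\<lambda>z. 2 * (cmod (f z))\<^sup>2 + 2 * (cmod (g z))\<^sup>2)"
    using assms by (auto simp: sq_integrable_def)
  then have "integrable torus (\<lambda>z. (cmod (f z + g z))\<^sup>2)"
  proof (rule Bochner_Integration.integrable_bound)
    have "(cmod (f z + g z))\<^sup>2 \<le> 2 * (cmod (f z))\<^sup>2 + 2 * (cmod (g z))\<^sup>2" for z
    proof -
      have "(cmod (f z + g z))\<^sup>2 \<le> (cmod (f z) + cmod (g z))\<^sup>2"
        by (intro power_mono norm_triangle_ineq) simp
      also have "\<dots> \<le> 2 * (cmod (f z))\<^sup>2 + 2 * (cmod (g z))\<^sup>2"
        using zero_le_power2[of "cmod (f z) - cmod (g z)"]
        by (simp add: power2_sum power2_diff)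
      finally show ?thesis .
    qed
    then show "AE z in torus. norm ((cmod (f z + g z))\<^sup>2)
        \<le> norm (2 * (cmod (f z))\<^sup>2 + 2 * (cmod (g z))\<^sup>2)"
      by simp
  qed simp
  then show ?thesis
    by (simp add: sq_integrable_def)
qed

lemma sq_integrable_cmult:
  "sq_integrable f \<Longrightarrow> sq_integrable (\<lambda>z. c * f z)"
  by (auto simp: sq_integrable_def norm_mult power_mult_distrib)

lemma integrable_mult_cnj:
  assumes "sq_integrable f" "sq_integrable g"
  shows "integrable torus (\<lambda>z. f z * cnj (g z))"
proof -
  have [measurable]: "f \<in> borel_measurable torus" "g \<in> borel_measurable torus"
    using assms by (auto simp: sq_integrable_def)
  have [measurable]: "cnj \<in> borel_measurable borel"
    by (intro borel_measurable_continuous_onI continuous_intros)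
  have "integrable torus (\<lambda>z. (cmod (f z))\<^sup>2 + (cmod (g z))\<^sup>2)"
    using assms by (auto simp: sq_integrable_def)
  then show ?thesis
  proof (rule Bochner_Integration.integrable_bound)
    have "cmod (f z) * cmod (g z) \<le> (cmod (f z))\<^sup>2 + (cmod (g z))\<^sup>2" for z
    proof -
      have "0 \<le> cmod (f z) * cmod (g z)" by simp
      then show ?thesis
        using zero_le_power2[of "cmod (f z) - cmod (g z)"] unfolding power2_diff by linarith
    qed
    then show "AE z in torus. norm (f z * cnj (g z)) \<le> norm ((cmod (f z))\<^sup>2 + (cmod (g z))\<^sup>2)"
      by (simp add: norm_mult)
  qed simp
qed

quotient_type 'n L2_torus = "('n::finite \<Rightarrow> complex) \<Rightarrow> complex" /
  partial: "\<lambda>f g. sq_integrable f \<and> sq_integrable g \<and> (AE z in torus. f z = g z)"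
proof (rule part_equivpI)
  show "\<exists>f. sq_integrable f \<and> sq_integrable f \<and>
      (AE z in (torus :: ('n::finite \<Rightarrow> complex) measure). f z = f z)"
    by (rule exI[of _ "\<lambda>_. 0"]) (simp add: sq_integrable_def)
  show "symp (\<lambda>f g. sq_integrable f \<and> sq_integrable g \<and>
      (AE z in (torus :: ('n::finite \<Rightarrow> complex) measure). f z = g z))"
    by (auto simp: symp_def eq_commute)
  show "transp (\<lambda>f g. sq_integrable f \<and> sq_integrable g \<and>
      (AE z in (torus :: ('n::finite \<Rightarrow> complex) measure). f z = g z))"
    unfolding transp_def by (auto elim: AE_mp)
qed

lift_definition cinner :: "'n::finite L2_torus \<Rightarrow> 'n L2_torus \<Rightarrow> complex" is
  "\<lambda>f g. LINT z|torus. f z * cnj (g z)"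
proof (elim conjE)
  fix f1 f2 g1 g2 :: "('n \<Rightarrow> complex) \<Rightarrow> complex"
  assume "sq_integrable f1" "sq_integrable f2" "sq_integrable g1" "sq_integrable g2"
  then have "integrable torus (\<lambda>z. f1 z * cnj (g1 z))" "integrable torus (\<lambda>z. f2 z * cnj (g2 z))"
    by (simp_all add: integrable_mult_cnj)
  moreover
  assume "AE z in torus. f1 z = f2 z" "AE z in torus. g1 z = g2 z"
  ultimately show "(LINT z|torus. f1 z * cnj (g1 z)) = (LINT z|torus. f2 z * cnj (g2 z))"
    by (intro integral_cong_AE) auto
qed

lift_definition scaleC :: "complex \<Rightarrow> 'n::finite L2_torus \<Rightarrow> 'n L2_torus" is
  "\<lambda>c f z. c * f z"
  by (auto simp: sq_integrable_cmult)

text \<open>The library's inner product spaces are real. The real part of \<open>cinner\<close>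
  gives the $L^2$ norm as \<open>norm\<close>; orthogonality and matrix entries have to
  be expressed with \<open>cinner\<close> itself.\<close>

instantiation L2_torus :: (finite) real_inner
begin

lift_definition zero_L2_torus :: "'a L2_torus" is "\<lambda>_. 0"
  by (simp add: sq_integrable_def)

lift_definition plus_L2_torus :: "'a L2_torus \<Rightarrow> 'a L2_torus \<Rightarrow> 'a L2_torus" is
  "\<lambda>f g z. f z + g z"
  by (auto simp: sq_integrable_add)

definition scaleR_L2_torus :: "real \<Rightarrow> 'a L2_torus \<Rightarrow> 'a L2_torus" where
  "scaleR_L2_torus r f = scaleC (complex_of_real r) f"

definition uminus_L2_torus :: "'a L2_torus \<Rightarrow> 'a L2_torus" where
  "uminus_L2_torus f = scaleC (- 1) f"

definition minus_L2_torus :: "'a L2_torus \<Rightarrow> 'a L2_torus \<Rightarrow> 'a L2_torus" where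
  "minus_L2_torus f g = f + (- g)"

definition inner_L2_torus :: "'a L2_torus \<Rightarrow> 'a L2_torus \<Rightarrow> real" where
  "inner_L2_torus f g = Re (cinner f g)"

definition norm_L2_torus :: "'a L2_torus \<Rightarrow> real" where
  "norm_L2_torus f = sqrt (inner f f)"

definition sgn_L2_torus :: "'a L2_torus \<Rightarrow> 'a L2_torus" where
  "sgn_L2_torus f = inverse (norm f) *\<^sub>R f"

definition dist_L2_torus :: "'a L2_torus \<Rightarrow> 'a L2_torus \<Rightarrow> real" where
  "dist_L2_torus f g = norm (f - g)"

definition uniformity_L2_torus :: "('a L2_torus \<times> 'a L2_torus) filter" where
  "uniformity_L2_torus = (INF e\<in>{0<..}. principal {(f, g). dist f g < e})"

definition open_L2_torus :: "'a L2_torus set \<Rightarrow> bool" where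
  "open_L2_torus U \<longleftrightarrow> (\<forall>f\<in>U. eventually (\<lambda>(f', g). f' = f \<longrightarrow> g \<in> U) uniformity)"

instance
proof
  fix f g h :: "'a L2_torus" and r s :: real
  show "f + g + h = f + (g + h)"
    by transfer (auto simp: sq_integrable_add add.assoc)
  show "f + g = g + f"
    by transfer (auto simp: sq_integrable_add add.commute)
  show "0 + f = f"
    by transfer auto
  show "- f + f = 0"
    unfolding uminus_L2_torus_def
    by transfer (auto simp: sq_integrable_def)
  show "f - g = f + - g"
    by (fact minus_L2_torus_def)
  show "r *\<^sub>R (f + g) = r *\<^sub>R f + r *\<^sub>R g"
    unfolding scaleR_L2_torus_def
    by transfer (auto simp: distrib_left sq_integrable_add sq_integrable_cmult)
  show "(r + s) *\<^sub>R f = r *\<^sub>R f + s *\<^sub>R f"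
    unfolding scaleR_L2_torus_def
    by transfer (auto simp: distrib_right sq_integrable_add sq_integrable_cmult)
  show "r *\<^sub>R s *\<^sub>R f = (r * s) *\<^sub>R f"
    unfolding scaleR_L2_torus_def
    by transfer (auto simp: mult.assoc sq_integrable_cmult)
  show "1 *\<^sub>R f = f"
    unfolding scaleR_L2_torus_def by transfer auto
  show "dist f g = norm (f - g)"
    by (fact dist_L2_torus_def)
  show "sgn f = inverse (norm f) *\<^sub>R f"
    by (fact sgn_L2_torus_def)
  show "uniformity = (INF e\<in>{0<..}. principal {(f :: 'a L2_torus, g). dist f g < e})"
    by (fact uniformity_L2_torus_def)
  show "open U \<longleftrightarrow> (\<forall>f\<in>U. eventually (\<lambda>(f', g). f' = f \<longrightarrow> g \<in> U) uniformity)"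
    for U :: "'a L2_torus set"
    by (fact open_L2_torus_def)
  show "norm f = sqrt (inner f f)"
    by (fact norm_L2_torus_def)
  show "inner f g = inner g f"
    unfolding inner_L2_torus_def
  proof transfer
    fix f g :: "('a \<Rightarrow> complex) \<Rightarrow> complex"
    have "(LINT z|torus. f z * cnj (g z)) = cnj (LINT z|torus. g z * cnj (f z))"
      by (simp add: mult.commute flip: Bochner_Integration.integral_cnj)
    then show "Re (LINT z|torus. f z * cnj (g z)) = Re (LINT z|torus. g z * cnj (f z))"
      by simp
  qed
  show "inner (f + g) h = inner f h + inner g h"
    unfolding inner_L2_torus_def
    by transfer (simp add: distrib_right integrable_mult_cnj)
  show "inner (r *\<^sub>R f) g = r * inner f g"
    unfolding inner_L2_torus_def scaleR_L2_torus_def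
    by transfer (simp add: mult.assoc)
  have inner_self: "Re (LINT z|torus. f z * cnj (f z)) = (LINT z|torus. (cmod (f z))\<^sup>2)"
    for f :: "('a \<Rightarrow> complex) \<Rightarrow> complex"
    by (simp add: complex_norm_square [symmetric] flip: of_real_power)
  show "0 \<le> inner f f"
    unfolding inner_L2_torus_def
    by transfer (simp add: inner_self)
  show "inner f f = 0 \<longleftrightarrow> f = 0"
    unfolding inner_L2_torus_def
  proof transfer
    fix f :: "('a \<Rightarrow> complex) \<Rightarrow> complex"
    assume "sq_integrable f \<and> sq_integrable f \<and> (AE z in torus. f z = f z)"
    then have f: "sq_integrable f" by simp
    have "(LINT z|torus. (cmod (f z))\<^sup>2) = 0 \<longleftrightarrow> (AE z in torus. (cmod (f z))\<^sup>2 = 0)"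
      using f by (intro integral_nonneg_eq_0_iff_AE) (auto simp: sq_integrable_def)
    then show "Re (LINT z|torus. f z * cnj (f z)) = 0 \<longleftrightarrow>
        sq_integrable f \<and> sq_integrable (\<lambda>_. 0 :: complex) \<and> (AE z in torus. f z = 0)"
      using f by (simp add: inner_self) (simp add: sq_integrable_def)
  qed
qed

end

lift_definition monom_e :: "('n::finite \<Rightarrow> int) \<Rightarrow> 'n L2_torus" is
  "\<lambda>m z. \<Prod>i\<in>UNIV. z i powi m i"
proof -
  fix m :: "'n \<Rightarrow> int"
  interpret prob_space "torus :: ('n \<Rightarrow> complex) measure"
    by (rule prob_space_torus)
  have [measurable]: "(\<lambda>z. \<Prod>i\<in>UNIV. z i powi m i) \<in> borel_measurable torus"
    unfolding power_int_def by measurable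
  have "cmod (\<Prod>i\<in>UNIV. z i powi m i) = 1" if "z \<in> space torus" for z :: "'n \<Rightarrow> complex"
    using that by (simp add: space_torus norm_power_int flip: prod_norm)
  then have "integrable torus (\<lambda>z :: 'n \<Rightarrow> complex. (cmod (\<Prod>i\<in>UNIV. z i powi m i))\<^sup>2)"
    by (subst Bochner_Integration.integrable_cong[OF refl, where g = "\<lambda>_. 1"]) auto
  then show "sq_integrable (\<lambda>z. \<Prod>i\<in>UNIV. z i powi m i) \<and>
      sq_integrable (\<lambda>z. \<Prod>i\<in>UNIV. z i powi m i) \<and>
      (AE z in torus. (\<Prod>i\<in>UNIV. z i powi m i) = (\<Prod>i\<in>UNIV. z i powi m i))"
    by (simp add: sq_integrable_def)
qed

section \<open>Slant Hankel operators\<close>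

definition bounded_clinear :: "('n::finite L2_torus \<Rightarrow> 'n L2_torus) \<Rightarrow> bool" where
  "bounded_clinear S \<longleftrightarrow>
     bounded_linear S \<and> (\<forall>c f. S (scaleC c f) = scaleC c (S f))"

definition L_infinity :: "(('n::finite \<Rightarrow> complex) \<Rightarrow> complex) set" where
  "L_infinity = {\<phi>. \<phi> \<in> borel_measurable torus \<and> (\<exists>C. AE z in torus. cmod (\<phi> z) \<le> C)}"

text \<open>Symbols in $L^\infty$ are given by representatives. Outside \<open>L_infinity\<close> the
  multiplication operator is set to 0 to make it total.\<close>

lift_definition mult_op ::
  "(('n::finite \<Rightarrow> complex) \<Rightarrow> complex) \<Rightarrow> 'n L2_torus \<Rightarrow> 'n L2_torus" is
  "\<lambda>\<phi> f z. if \<phi> \<in> L_infinity then \<phi> z * f z else 0"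
proof -
  fix \<phi> f g :: "('n \<Rightarrow> complex) \<Rightarrow> complex"
  assume fg: "sq_integrable f \<and> sq_integrable g \<and> (AE z in torus. f z = g z)"
  have *: "sq_integrable (\<lambda>z. if \<phi> \<in> L_infinity then \<phi> z * h z else 0)"
    if "sq_integrable h" for h
  proof (cases "\<phi> \<in> L_infinity")
    case True
    then obtain C where [measurable]: "\<phi> \<in> borel_measurable torus"
      and C: "AE z in torus. cmod (\<phi> z) \<le> C"
      by (auto simp: L_infinity_def)
    have [measurable]: "h \<in> borel_measurable torus"
      using that by (simp add: sq_integrable_def)
    have "integrable torus (\<lambda>z. C\<^sup>2 * (cmod (h z))\<^sup>2)"
      using that by (simp add: sq_integrable_def)
    then have "integrable torus (\<lambda>z. (cmod (\<phi> z * h z))\<^sup>2)"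
    proof (rule Bochner_Integration.integrable_bound)
      show "AE z in torus. norm ((cmod (\<phi> z * h z))\<^sup>2) \<le> norm (C\<^sup>2 * (cmod (h z))\<^sup>2)"
        using C by eventually_elim
          (auto simp: norm_mult power_mult_distrib intro!: mult_right_mono power_mono)
    qed simp
    then show ?thesis
      using True by (simp add: sq_integrable_def)
  qed (simp add: sq_integrable_def)
  show "sq_integrable (\<lambda>z. if \<phi> \<in> L_infinity then \<phi> z * f z else 0) \<and>
      sq_integrable (\<lambda>z. if \<phi> \<in> L_infinity then \<phi> z * g z else 0) \<and>
      (AE z in torus. (if \<phi> \<in> L_infinity then \<phi> z * f z else 0) =
        (if \<phi> \<in> L_infinity then \<phi> z * g z else 0))"
    using fg * by (auto elim: AE_mp)
qed

text \<open>The operator \<open>V_op k\<close> is determined by its values on the orthonormal basis of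
  the \<open>monom_e m\<close>.\<close>

definition V_op :: "nat \<Rightarrow> 'n::finite L2_torus \<Rightarrow> 'n L2_torus" where
  "V_op k = (THE V. bounded_clinear V \<and>
     (\<forall>m. V (monom_e m) =
        (if \<forall>i. int k dvd m i then monom_e (\<lambda>i. - (m i div int k)) else 0)))"

definition slant_hankel_operator :: "nat \<Rightarrow> ('n::finite L2_torus \<Rightarrow> 'n L2_torus) \<Rightarrow> bool" where
  "slant_hankel_operator k S \<longleftrightarrow> (\<exists>\<phi>\<in>L_infinity. S = V_op k \<circ> mult_op \<phi>)"

section \<open>Slant Hankel matrices\<close>

text \<open>The block recursion. In \<open>slant_hankel_block k a js m\<close> the list \<open>js\<close> holds the
  coordinates that index rows and columns, outermost level first, so its length is the level;
  the remaining coordinates are fixed to the values given by \<open>m\<close>. The block in row \<open>p j\<close> and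
  column \<open>q j\<close> of a matrix with outermost level \<open>j\<close> is the matrix of the next lower level
  with \<open>j\<close>-th subscript \<open>- k * p j - q j\<close>; a matrix of level 0 is a scalar.\<close>

primrec slant_hankel_block ::
  "nat \<Rightarrow> (('n \<Rightarrow> int) \<Rightarrow> complex) \<Rightarrow> 'n list \<Rightarrow>
    ('n \<Rightarrow> int) \<Rightarrow> ('n \<Rightarrow> int) \<Rightarrow> ('n \<Rightarrow> int) \<Rightarrow> complex" where
  "slant_hankel_block k a [] m p q = a m"
| "slant_hankel_block k a (j # js) m p q =
     slant_hankel_block k a js (m(j := - int k * p j - q j)) p q"

text \<open>The matrix \<open>B\<close> has level \<open>CARD('n)\<close>; \<open>B p q\<close> is its entry in row \<open>p\<close> and column \<open>q\<close>.
  The list \<open>js\<close> enumerates all coordinates, so the initial subscript \<open>\<lambda>_. 0\<close> is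
  overwritten completely, and by \<open>slant_hankel_matrix_iff\<close> below the order of the
  enumeration does not matter.\<close>

definition slant_hankel_matrix ::
  "nat \<Rightarrow> (('n::finite \<Rightarrow> int) \<Rightarrow> ('n \<Rightarrow> int) \<Rightarrow> complex) \<Rightarrow> bool" where
  "slant_hankel_matrix k B \<longleftrightarrow>
     (\<exists>a js. distinct js \<and> set js = UNIV \<and> B = slant_hankel_block k a js (\<lambda>_. 0))"

lemma slant_hankel_block_eq:
  "slant_hankel_block k a js m p q =
     a (\<lambda>i. if i \<in> set js then - int k * p i - q i else m i)"
  by (induction js arbitrary: m) (auto intro!: arg_cong[where f = a])

lemma slant_hankel_matrix_iff:
  "slant_hankel_matrix k B \<longleftrightarrow> (\<exists>a. \<forall>p q. B p q = a (\<lambda>i. - int k * p i - q i))"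
proof -
  obtain js :: "'a list" where "distinct js" "set js = UNIV"
    using finite_distinct_list[of "UNIV :: 'a set"] by auto
  then show ?thesis
    unfolding slant_hankel_matrix_def fun_eq_iff slant_hankel_block_eq
    by (intro ex_cong1 iffI) (auto intro!: exI[of _ js])
qed

definition operator_matrix ::
  "('n::finite L2_torus \<Rightarrow> 'n L2_torus) \<Rightarrow> ('n \<Rightarrow> int) \<Rightarrow> ('n \<Rightarrow> int) \<Rightarrow> complex" where
  "operator_matrix S m' m = cinner (S (monom_e m)) (monom_e m')"

end

(* Write q(z) = (z_1^(-k), ..., z_n^(-k)), W f = f o q and M_m for multiplication by the character e_m.
   Since q preserves Haar measure, W is an isometry, and V_k is its adjoint: V_k f (z) is the average
   of f over the roots w of q(w) = z. Hence <V_k M_phi e_m, e_m'> = <phi e_m, e_(-k m')> depends on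
   -k m' - m only. Conversely let S be bounded with matrix entries a_(-k m' - m) and put
   T = sum_r M_(-r) W S M_r over the residues r in {0..k-1}^n. In <T e_m, e_l> only the r with
   k | r + l contributes, and it contributes a_(l-m), so T e_m = phi e_m with phi = T 1. A bounded
   operator with this property is the multiplication by a bounded phi, and V_k M_phi has the matrix
   of S. Density of the trigonometric polynomials in L^2 and invariance of Haar measure
   under rotations and q both come from one monotone class argument based on the Stone-Weierstrass
   theorem. *)

theory Submission
  imports Defs
begin

section \<open>Characters and trigonometric polynomials\<close>

text \<open>The formula for \<open>T\<close> undoes \<open>V_k\<close> frequency class by frequency
  class. \<open>W V_k\<close> is the orthogonal projection onto the closed span of the characters
  whose index is divisible by \<open>k\<close>, so the sum of \<open>M_(-r) W V_k M_r\<close> over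
  all residues is the identity. As multiplications commute, inserting \<open>S = V_k M_phi\<close>
  returns \<open>M_phi\<close>. For a general \<open>S\<close> the same finite sum is a bounded
  operator without any estimate on the numbers \<open>a_l\<close>, and its boundedness is what later
  bounds phi. Values prescribed on the basis do not by themselves provide a bounded operator
  \<open>V_k\<close>; the average over roots is what constructs it. Its fibres move with the point,
  which makes measurability and null sets delicate. Composed with \<open>q\<close> it becomes an
  average of finitely many fixed rotations, and as \<open>W\<close> is an isometry, identities and
  bounds for \<open>V_k\<close> can be read off there.\<close>

definition character :: "('n::finite \<Rightarrow> int) \<Rightarrow> ('n \<Rightarrow> complex) \<Rightarrow> complex" where
  "character m z = (\<Prod>i\<in>UNIV. z i powi m i)"

lemma measurable_character [measurable]: "character m \<in> borel_measurable torus"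
  unfolding character_def power_int_def by measurable

lemma character_0 [simp]: "character (\<lambda>_. 0) z = 1"
  by (simp add: character_def)

lemma character_mult:
  "character m (\<lambda>i. w i * z i) = character m w * character m z"
  by (simp add: character_def power_int_mult_distrib prod.distrib)

lemma norm_character: "z \<in> space torus \<Longrightarrow> cmod (character m z) = 1"
  by (simp add: character_def space_torus norm_power_int flip: prod_norm)

lemma character_add:
  assumes "z \<in> space torus"
  shows "character (\<lambda>i. m i + m' i) z = character m z * character m' z"
proof -
  have "z i \<noteq> 0" for i
    using assms by (auto simp: space_torus dest: spec[of _ i])
  then show ?thesis
    by (simp add: character_def power_int_add prod.distrib)
qed

lemma cnj_character:
  assumes "z \<in> space torus"
  shows "cnj (character m z) = character (\<lambda>i. - m i) z"
proof -
  have "cnj (z i) = inverse (z i)" for i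
    using assms complex_norm_square[of "z i"]
    by (intro inverse_unique[symmetric]) (simp add: space_torus)
  then have "cnj (z i powi m i) = z i powi (- m i)" for i
    by (simp add: power_int_def power_inverse)
  then show ?thesis
    by (simp add: character_def cnj_prod)
qed

text \<open>Products are not among the rules: a property of all trigonometric polynomials then
  follows from the characters by linearity alone, which is what the classes \<open>C\<close> of the
  monotone class argument provide.\<close>

inductive_set trig_poly :: "(('n::finite \<Rightarrow> complex) \<Rightarrow> complex) set" where
  character: "character m \<in> trig_poly"
| add: "p \<in> trig_poly \<Longrightarrow> q \<in> trig_poly \<Longrightarrow> (\<lambda>z. p z + q z) \<in> trig_poly"
| cmult: "p \<in> trig_poly \<Longrightarrow> (\<lambda>z. c * p z) \<in> trig_poly"

lemma trig_poly_const: "(\<lambda>_. c) \<in> trig_poly"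
proof -
  have "(\<lambda>z. c * character (\<lambda>_. 0) z) \<in> trig_poly"
    by (intro trig_poly.intros)
  then show ?thesis by simp
qed

text \<open>Bilinearity reduces this to two characters, whose indices add. The identity is claimed
  on the torus only, since the exponent law for \<open>powi\<close> fails at vanishing
  coordinates.\<close>

lemma trig_poly_mult:
  assumes "p \<in> trig_poly" "q \<in> trig_poly"
  shows "\<exists>r\<in>trig_poly. \<forall>z\<in>space torus. r z = p z * q z"
  using assms(1)
proof induction
  case (character m)
  show ?case
    using assms(2)
  proof induction
    case (character m')
    show ?case
      by (rule bexI[of _ "character (\<lambda>i. m i + m' i)"])
        (simp_all add: character_add trig_poly.character)
  next
    case (add p q)
    then obtain r r' where "r \<in> trig_poly" "\<forall>z\<in>space torus. r z = character m z * p z"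
      "r' \<in> trig_poly" "\<forall>z\<in>space torus. r' z = character m z * q z" by blast
    then show ?case
      by (intro bexI[of _ "\<lambda>z. r z + r' z"]) (simp_all add: trig_poly.add distrib_left)
  next
    case (cmult p c)
    then obtain r where "r \<in> trig_poly" "\<forall>z\<in>space torus. r z = character m z * p z" by blast
    then show ?case
      by (intro bexI[of _ "\<lambda>z. c * r z"]) (simp_all add: trig_poly.cmult)
  qed
next
  case (add p p')
  then obtain r r' where "r \<in> trig_poly" "\<forall>z\<in>space torus. r z = p z * q z"
    "r' \<in> trig_poly" "\<forall>z\<in>space torus. r' z = p' z * q z" by blast
  then show ?case
    by (intro bexI[of _ "\<lambda>z. r z + r' z"]) (simp_all add: trig_poly.add distrib_right)
next
  case (cmult p c)
  then obtain r where "r \<in> trig_poly" "\<forall>z\<in>space torus. r z = p z * q z" by blast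
  then show ?case
    by (intro bexI[of _ "\<lambda>z. c * r z"]) (simp_all add: trig_poly.cmult)
qed

text \<open>Real and imaginary parts of the coordinates separate points, as Stone-Weierstrass
  requires. They are combinations of a coordinate and its conjugate, and on the torus the conjugate
  is the character of exponent \<open>- 1\<close>.\<close>

lemma trig_poly_component:
  fixes i :: "'n::finite"
  shows "\<exists>p\<in>trig_poly. \<forall>z\<in>space torus. p z = complex_of_real (Re (z i))"
    and "\<exists>p\<in>trig_poly. \<forall>z\<in>space torus. p z = complex_of_real (Im (z i))"
proof -
  define e :: "int \<Rightarrow> 'n \<Rightarrow> int" where "e s = (\<lambda>_. 0)(i := s)" for s
  have e: "character (e s) z = z i powi s" for s z
  proof -
    have "character (e s) z = (\<Prod>j\<in>UNIV. if j = i then z j powi s else 1)"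
      unfolding character_def e_def by (intro prod.cong) auto
    then show ?thesis by simp
  qed
  have cnj: "character (e (- 1)) z = cnj (z i)" if "z \<in> space torus" for z
    using cnj_character[OF that, of "e 1"] e[of 1 z] e[of "- 1" z]
    by (simp add: e_def fun_upd_def if_distrib[of uminus] cong: if_cong)
  have "complex_of_real (Re w) = (1/2) * w + (1/2) * cnj w"
    and "complex_of_real (Im w) = (- \<i>/2) * w + (\<i>/2) * cnj w" for w
    by (simp_all add: complex_eq_iff)
  then have ReIm1: "\<forall>z\<in>space torus. (1/2) * character (e 1) z + (1/2) * character (e (- 1)) z
      = complex_of_real (Re (z i))"
    and ReIm2: "\<forall>z\<in>space torus. (- \<i>/2) * character (e 1) z + (\<i>/2) * character (e (- 1)) z
      = complex_of_real (Im (z i))"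
    by (simp_all add: e[of 1] cnj)
  have trig: "(\<lambda>z. c * character (e 1) z + d * character (e (- 1)) z) \<in> trig_poly" for c d
    by (intro trig_poly.intros)
  show "\<exists>p\<in>trig_poly. \<forall>z\<in>space torus. p z = complex_of_real (Re (z i))"
    by (rule bexI, rule ReIm1, rule trig)
  show "\<exists>p\<in>trig_poly. \<forall>z\<in>space torus. p z = complex_of_real (Im (z i))"
    by (rule bexI, rule ReIm2, rule trig)
qed

section \<open>Uniform approximation and the Borel structure of the torus\<close>

lemma compact_space_torus: "compact (space (torus :: ('n::finite \<Rightarrow> complex) measure))"
proof -
  have "compactin (product_topology (\<lambda>_. euclidean) UNIV) (PiE UNIV (\<lambda>_::'n. sphere (0::complex) 1))"
    by (subst compactin_PiE) simp
  then show ?thesis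
    by (simp add: euclidean_product_topology space_torus PiE_def Pi_def)
qed

text \<open>The real form of Stone-Weierstrass is applied to the ring \<open>R\<close> of continuous
  real functions that agree on the torus with some trigonometric polynomial; complex coefficients
  occur only in these witnesses.\<close>

lemma trig_poly_dense:
  fixes f :: "('n::finite \<Rightarrow> complex) \<Rightarrow> real"
  assumes f: "continuous_on (space torus) f" and e: "e > 0"
  shows "\<exists>p\<in>trig_poly. \<forall>z\<in>space torus. cmod (complex_of_real (f z) - p z) < e"
proof -
  define R :: "(('n \<Rightarrow> complex) \<Rightarrow> real) set" where "R = {f. continuous_on (space torus) f \<and>
    (\<exists>p\<in>trig_poly. \<forall>z\<in>space torus. p z = complex_of_real (f z))}"
  interpret function_ring_on R "space torus"
  proof
    show "compact (space torus :: ('n \<Rightarrow> complex) set)"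
      by (rule compact_space_torus)
    show "continuous_on (space torus) f" if "f \<in> R" for f
      using that by (simp add: R_def)
    show "(\<lambda>x. f x + g x) \<in> R" if "f \<in> R" "g \<in> R" for f g
    proof -
      from that obtain p q where "p \<in> trig_poly" "\<forall>z\<in>space torus. p z = complex_of_real (f z)"
        "q \<in> trig_poly" "\<forall>z\<in>space torus. q z = complex_of_real (g z)"
        by (auto simp: R_def)
      then show ?thesis
        using that by (auto simp: R_def intro!: continuous_intros bexI[of _ "\<lambda>z. p z + q z"] trig_poly.add)
    qed
    show "(\<lambda>x. f x * g x) \<in> R" if "f \<in> R" "g \<in> R" for f g
    proof -
      from that obtain p q where pq: "p \<in> trig_poly" "\<forall>z\<in>space torus. p z = complex_of_real (f z)"
        "q \<in> trig_poly" "\<forall>z\<in>space torus. q z = complex_of_real (g z)"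
        by (auto simp: R_def)
      then obtain r where "r \<in> trig_poly" "\<forall>z\<in>space torus. r z = p z * q z"
        using trig_poly_mult by blast
      then show ?thesis
        using that pq by (auto simp: R_def intro!: continuous_intros bexI[of _ r])
    qed
    show "(\<lambda>_. c) \<in> R" for c
      by (auto simp: R_def trig_poly_const intro!: bexI[of _ "\<lambda>_. complex_of_real c"])
    show "\<exists>f\<in>R. f x \<noteq> f y" if "x \<noteq> y" for x y :: "'n \<Rightarrow> complex"
    proof -
      from that obtain i where "x i \<noteq> y i" by blast
      moreover have "(\<lambda>z. Re (z i)) \<in> R" "(\<lambda>z. Im (z i)) \<in> R"
        using trig_poly_component[of i]
        by (auto simp: R_def intro!: continuous_intros continuous_on_product_coordinates
            continuous_on_subset[OF continuous_on_product_coordinates])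
      moreover have "Re (x i) \<noteq> Re (y i) \<or> Im (x i) \<noteq> Im (y i)"
        using \<open>x i \<noteq> y i\<close> by (simp add: complex_eq_iff)
      ultimately show ?thesis
        by (elim disjE) (rule bexI; assumption)+
    qed
  qed
  obtain g where "g \<in> R" "\<forall>z\<in>space torus. \<bar>f z - g z\<bar> < e"
    using Stone_Weierstrass_basic[OF f e] by blast
  then obtain p where "p \<in> trig_poly" "\<forall>z\<in>space torus. p z = complex_of_real (g z)"
    by (auto simp: R_def)
  then show ?thesis
    using \<open>\<forall>z\<in>space torus. \<bar>f z - g z\<bar> < e\<close>
    by (intro bexI[of _ p]) (auto simp flip: of_real_diff)
qed

lemma measurable_torus_borel: "(\<lambda>z. z) \<in> borel_measurable (torus :: ('n::finite \<Rightarrow> complex) measure)"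
  by (rule measurable_coordinatewise_then_product) simp

text \<open>Together with \<open>measurable_torus_borel\<close>, this identifies the product
  sigma-algebra with the trace of the Borel sets of the product topology. The generating cylinders
  are traces of preimages of Borel sets under continuous projections.\<close>

lemma sets_torus_le:
  fixes A :: "('n::finite \<Rightarrow> complex) set"
  assumes "A \<in> sets torus"
  shows "\<exists>B\<in>sets borel. A = B \<inter> space torus"
proof -
  have "A \<in> sigma_sets (space torus) {{f \<in> space torus. f i \<in> A} | i A. i \<in> UNIV \<and> A \<in> sets circle}"
    using assms unfolding torus_def sets_PiM_single space_PiM .
  moreover have "\<dots> \<subseteq> sets (restrict_space borel (space torus) :: ('n \<Rightarrow> complex) measure)"
  proof -
    have "{f \<in> space torus. f i \<in> A} \<in> sets (restrict_space borel (space torus))"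
      if "A \<in> sets circle" for i :: 'n and A
    proof -
      from that obtain B where B: "B \<in> sets borel" "A = sphere 0 1 \<inter> B"
        by (auto simp: circle_def sets_restrict_space)
      have "(\<lambda>f. f i) -` B \<inter> space borel \<in> sets (borel :: ('n \<Rightarrow> complex) measure)"
        using B by (intro measurable_sets[OF borel_measurable_continuous_onI] continuous_on_product_coordinates)
      moreover have "{f \<in> space torus. f i \<in> A} = space torus \<inter> ((\<lambda>f. f i) -` B \<inter> space borel)"
        using B by (auto simp: space_torus)
      ultimately show ?thesis
        by (auto simp: sets_restrict_space)
    qed
    then show ?thesis
      by (intro sets.sigma_sets_subset[of _ "restrict_space borel (space torus)",
            unfolded space_restrict_space space_borel Int_UNIV_right]) (rule subsetI, elim CollectE exE conjE, simp)
  qed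
  ultimately have "A \<in> (\<inter>) (space torus) ` sets borel"
    by (simp add: sets_restrict_space subset_iff)
  then show ?thesis
    by (auto simp: Int_commute)
qed

text \<open>Membership in \<open>C\<close> passes from trigonometric polynomials to bounded
  continuous functions, to closed sets and, by Dynkin's lemma, to Borel sets. The assumption
  \<open>lim\<close> asks only for uniformly bounded pointwise limits, so dominated convergence
  provides it both for equality of two integrals and for membership in a closed subspace of the
  Hilbert space.\<close>

lemma bounded_class_indicator:
  fixes C :: "(('n::finite \<Rightarrow> complex) \<Rightarrow> complex) \<Rightarrow> bool"
  assumes char: "\<And>m. C (character m)"
    and add: "\<And>f g. C f \<Longrightarrow> C g \<Longrightarrow> C (\<lambda>z. f z + g z)"
    and cmult: "\<And>c f. C f \<Longrightarrow> C (\<lambda>z. c * f z)"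
    and lim: "\<And>F f B. (\<And>n. C (F n)) \<Longrightarrow> (\<And>n z. z \<in> space torus \<Longrightarrow> cmod (F n z) \<le> B) \<Longrightarrow>
        (\<And>z. z \<in> space torus \<Longrightarrow> (\<lambda>n. F n z) \<longlonglongrightarrow> f z) \<Longrightarrow> f \<in> borel_measurable torus \<Longrightarrow> C f"
    and A: "A \<in> sets torus"
  shows "C (indicator A)"
proof -
  have trig: "C p" if "p \<in> trig_poly" for p
    using that by induction (auto intro: char add cmult)
  have cont: "C (\<lambda>z. complex_of_real (f z))"
    if f: "continuous_on UNIV f" and b: "\<And>z. \<bar>f z\<bar> \<le> 1" for f :: "('n \<Rightarrow> complex) \<Rightarrow> real"
  proof -
    have "\<exists>p\<in>trig_poly. \<forall>z\<in>space torus. cmod (complex_of_real (f z) - p z) < 1 / real (Suc n)" for n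
      by (intro trig_poly_dense continuous_on_subset[OF f]) auto
    then obtain p where p: "\<And>n. p n \<in> trig_poly"
      "\<And>n z. z \<in> space torus \<Longrightarrow> cmod (complex_of_real (f z) - p n z) < 1 / real (Suc n)"
      by metis
    show ?thesis
    proof (rule lim)
      show "C (p n)" for n
        by (rule trig[OF p(1)])
      \<comment> \<open>Bound 1 for \<open>f\<close> plus an approximation error of at most
        1.\<close>
      show "cmod (p n z) \<le> 2" if "z \<in> space torus" for n z
      proof -
        have "cmod (p n z) \<le> cmod (complex_of_real (f z)) + cmod (complex_of_real (f z) - p n z)"
          by (metis norm_minus_commute norm_triangle_sub)
        also have "cmod (complex_of_real (f z) - p n z) \<le> 1"
          using p(2)[OF that, of n] by (rule order.trans[OF less_imp_le]) simp
        finally show ?thesis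
          using b[of z] by simp
      qed
      show "(\<lambda>n. p n z) \<longlonglongrightarrow> complex_of_real (f z)" if "z \<in> space torus" for z
      proof (rule LIM_zero_cancel, rule Lim_null_comparison)
        show "\<forall>\<^sub>F n in sequentially. norm (p n z - complex_of_real (f z)) \<le> 1 / real (Suc n)"
          using p(2)[OF that] by (auto simp: norm_minus_commute intro!: always_eventually less_imp_le)
        show "(\<lambda>n. 1 / real (Suc n)) \<longlonglongrightarrow> 0"
          using LIMSEQ_inverse_real_of_nat by (simp add: inverse_eq_divide)
      qed
      show "(\<lambda>z. complex_of_real (f z)) \<in> borel_measurable torus"
        by (intro measurable_compose[OF measurable_torus_borel] borel_measurable_continuous_onI
            continuous_on_of_real f)
    qed
  qed
  have one: "C (\<lambda>_. 1)"
    using char[of "\<lambda>_. 0"] by (subst (asm) ext[OF character_0])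
  have meas: "(indicator B :: ('n \<Rightarrow> complex) \<Rightarrow> complex) \<in> borel_measurable torus" if "B \<in> sets borel" for B
    using that by (intro measurable_compose[OF measurable_torus_borel]) simp
  have closed: "C (indicator F)" if "closed F" for F
  proof (cases "F = {}")
    \<comment> \<open>\<open>infdist z {}\<close> is 0 by convention, so the functions
      \<open>f n\<close> of the other case would not tend to the indicator of the empty set.\<close>
    case True
    then show ?thesis
      using cmult[OF one, of 0] by (simp add: indicator_def[abs_def])
  next
    case False
    \<comment> \<open>Continuous, equal to 1 on \<open>F\<close>, and equal to 0 as soon as
      \<open>n * infdist z F \<ge> 1\<close>.\<close>
    define f where "f n z = max 0 (1 - real n * infdist z F)" for n z
    show ?thesis
    proof (rule lim)
      show "C (\<lambda>z. complex_of_real (f n z))" for n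
        unfolding f_def by (intro cont continuous_intros) (auto simp: infdist_nonneg)
      show "cmod (complex_of_real (f n z)) \<le> 1" for n z
        by (auto simp: f_def infdist_nonneg)
      show "(\<lambda>n. complex_of_real (f n z)) \<longlonglongrightarrow> indicator F z" for z
      proof (cases "z \<in> F")
        case True
        then show ?thesis by (simp add: f_def)
      next
        case z: False
        then have "infdist z F > 0"
          using False that infdist_pos_not_in_closed by blast
        then obtain N where N: "1 < real N * infdist z F"
          using reals_Archimedean3 by blast
        have "f n z = 0" if "n \<ge> N" for n
        proof -
          have "real N * infdist z F \<le> real n * infdist z F"
            using that by (intro mult_right_mono) (auto simp: infdist_nonneg)
          then show ?thesis using N by (simp add: f_def)
        qed
        then have "\<forall>\<^sub>F n in sequentially. complex_of_real (f n z) = indicator F z"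
          using z by (auto simp: eventually_sequentially)
        then show ?thesis
          by (rule tendsto_eventually)
      qed
      show "(indicator F :: _ \<Rightarrow> complex) \<in> borel_measurable torus"
        using that by (intro meas) simp
    qed
  qed
  have borel: "C (indicator B)" if "B \<in> sets borel" for B
  proof -
    \<comment> \<open>Closed sets are an intersection stable generator of the Borel sets.
      Complements use the constant 1, disjoint unions the bounded limit of partial sums.\<close>
    have "Int_stable (Collect closed :: ('n \<Rightarrow> complex) set set)"
      by (auto simp: Int_stable_def)
    moreover have "Collect closed \<subseteq> Pow (UNIV :: ('n \<Rightarrow> complex) set)"
      by simp
    moreover have "B \<in> sigma_sets UNIV (Collect closed)"
      using that by (simp add: borel_eq_closed)
    ultimately show ?thesis
    proof (induction rule: sigma_sets_induct_disjoint)
      case (basic F)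
      then show ?case by (simp add: closed)
    next
      case empty
      then show ?case by (rule closed) simp
    next
      case (compl B)
      then have "C (\<lambda>z. 1 + (- 1) * indicator B z)"
        by (intro add one cmult)
      also have "(\<lambda>z. 1 + (- 1) * indicator B z :: complex) = indicator (UNIV - B)"
        by (auto simp: indicator_def)
      finally show ?case .
    next
      case (union B)
      have sum: "(\<Sum>i<n. indicator (B i) z) = (indicator (\<Union>i<n. B i) z :: complex)" for n z
        by (rule indicator_UN_disjoint[symmetric])
          (auto intro: disjoint_family_on_mono[OF _ union(1)])
      show ?case
      proof (rule lim)
        show "C (\<lambda>z. \<Sum>i<n. indicator (B i) z)" for n
        proof (induction n)
          case 0
          then show ?case using closed[of "{}"] by (simp add: indicator_def[abs_def])
        next
          case (Suc n)
          then show ?case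
            unfolding sum.lessThan_Suc by (intro add union)
        qed
        show "cmod (\<Sum>i<n. indicator (B i) z) \<le> 1" for n z
          unfolding sum by (simp add: indicator_def)
        show "(\<lambda>n. \<Sum>i<n. indicator (B i) z) \<longlonglongrightarrow> (indicator (\<Union>i. B i) z :: complex)" for z
          unfolding sum by (rule LIMSEQ_indicator_UN)
        show "(indicator (\<Union>i. B i) :: _ \<Rightarrow> complex) \<in> borel_measurable torus"
          using union(2) by (intro meas sets.countable_UN) (auto simp: borel_eq_closed)
      qed
    qed
  qed
  obtain B where B: "B \<in> sets borel" "A = B \<inter> space torus"
    using sets_torus_le[OF A] by blast
  show ?thesis
  \<comment> \<open>\<open>indicator B\<close> and \<open>indicator A\<close> agree on the torus but
    may differ elsewhere; a constant sequence in \<open>lim\<close> replaces one by the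
    other.\<close>
  proof (rule lim[of "\<lambda>_. indicator B"])
    show "C (indicator B)" using B by (intro borel)
    show "cmod (indicator B z) \<le> 1" for z by (simp add: indicator_def)
    show "(\<lambda>n. indicator B z :: complex) \<longlonglongrightarrow> indicator A z" if "z \<in> space torus" for z
      using that B by (simp add: indicator_def)
    show "(indicator A :: _ \<Rightarrow> complex) \<in> borel_measurable torus"
      using A by simp
  qed
qed

section \<open>Invariance of Haar measure\<close>

lemma borel_measurable_powi: "(\<lambda>z. z powi m :: complex) \<in> borel_measurable borel"
  unfolding power_int_def by measurable

lemma integral_circle_powi:
  "(LINT z|circle. z powi m) = (if m = 0 then 1 else 0)"
proof (cases "m = 0")
  case True
  then show ?thesis
    using prob_space.prob_space[OF prob_space_circle] by simp
next
  case m: False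
  have [measurable]: "cis \<in> borel_measurable borel"
    by (intro borel_measurable_continuous_onI continuous_intros)
  have meas: "(\<lambda>t::real. cis (2 * pi * t)) \<in> borel_measurable borel"
    by measurable
  \<comment> \<open>A primitive of \<open>t \<mapsto> cis (2 * pi * m * t)\<close>; it takes the
    same value at 0 and at 1 because \<open>m\<close> is an integer.\<close>
  define F where "F t = cis (2 * pi * real_of_int m * t) / (2 * pi * real_of_int m * \<i>)" for t
  have "(LINT z|circle. z powi m) =
      (LINT t|restrict_space lborel {0..<1::real}. cis (2 * pi * t) powi m)"
    unfolding circle_def
  proof (subst integral_distr)
    show "(\<lambda>t. cis (2 * pi * t)) \<in> measurable (restrict_space lborel {0..<1::real})
      (restrict_space borel (sphere 0 1))"
      using meas by (intro measurable_restrict_space3) (auto simp: measurable_lborel1)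
    show "(\<lambda>z::complex. z powi m) \<in> borel_measurable (restrict_space borel (sphere 0 1))"
      by (intro measurable_restrict_space1 borel_measurable_powi)
  qed simp
  also have "\<dots> = (LINT t|lborel. indicator {0..<1::real} t *\<^sub>R cis (2 * pi * t) powi m)"
    by (rule integral_restrict_space) simp
  \<comment> \<open>The half-open interval is replaced by the closed one of the fundamental theorem;
    they differ in the null set \<open>{1}\<close>.\<close>
  also have "\<dots> = (LINT t|lborel. indicator {0..1} t *\<^sub>R cis (2 * pi * real_of_int m * t))"
  proof (rule integral_cong_AE)
    show "AE t in lborel. indicator {0..<1::real} t *\<^sub>R cis (2 * pi * t) powi m =
        indicator {0..1} t *\<^sub>R cis (2 * pi * real_of_int m * t)"
      using AE_lborel_singleton[of "1::real"]
      by eventually_elim (auto simp: indicator_def cis_power_int mult_ac)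
    show "(\<lambda>t. indicator {0..1} t *\<^sub>R cis (2 * pi * real_of_int m * t)) \<in> borel_measurable lborel"
      by measurable
    show "(\<lambda>t. indicator {0..<1::real} t *\<^sub>R cis (2 * pi * t) powi m) \<in> borel_measurable lborel"
      unfolding cis_power_int by measurable
  qed
  also have "\<dots> = F 1 - F 0"
  proof (rule integral_FTC_Icc)
    show "continuous_on {0..1} (\<lambda>t. cis (2 * pi * real_of_int m * t))"
      by (intro continuous_intros)
    show "(F has_vector_derivative cis (2 * pi * real_of_int m * t)) (at t within {0..1})" for t
      unfolding F_def cis_conv_exp
      by (rule derivative_eq_intros has_vector_derivative_real_field field_differentiable_derivI refl | use m in simp)+
  qed simp
  also have "F 1 = F 0"
    using cis_multiple_2pi[of "real_of_int m"] by (simp add: F_def)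
  finally show ?thesis
    using m by simp
qed

lemma integral_character:
  "(LINT z|torus. character m z) = (if m = (\<lambda>_. 0) then 1 else 0)"
proof -
  interpret product_sigma_finite "\<lambda>_. circle"
    by (intro product_sigma_finite.intro prob_space_imp_sigma_finite prob_space_circle)
  interpret circle: prob_space circle
    by (rule prob_space_circle)
  have "integrable circle (\<lambda>z. z powi l)" for l
  proof (rule circle.integrable_const_bound[of _ 1])
    show "AE z in circle. cmod (z powi l) \<le> 1"
      by (rule AE_I2) (simp add: space_circle norm_power_int)
    show "(\<lambda>z. z powi l) \<in> borel_measurable circle"
      unfolding circle_def by (simp add: measurable_restrict_space1 borel_measurable_powi)
  qed
  then have "(LINT z|torus. character m z) = (\<Prod>i\<in>UNIV. LINT z|circle. z powi m i)"
    unfolding torus_def character_def by (intro product_integral_prod) auto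
  also have "\<dots> = (if m = (\<lambda>_. 0) then 1 else 0)"
    by (auto simp: integral_circle_powi fun_eq_iff)
  finally show ?thesis .
qed

lemma integrable_character:
  assumes "finite_measure M" "sets M = sets torus"
  shows "integrable M (character m)"
proof (rule finite_measure.integrable_const_bound[OF assms(1)])
  show "AE z in M. cmod (character m z) \<le> 1"
    using sets_eq_imp_space_eq[OF assms(2)] by (intro AE_I2) (simp add: norm_character)
  show "character m \<in> borel_measurable M"
    using assms(2) by (simp cong: measurable_cong_sets)
qed

lemma bounded_convergence:
  fixes f :: "'a \<Rightarrow> complex"
  assumes "finite_measure M" and F: "\<And>n. F n \<in> borel_measurable M"
    and B: "\<And>n z. z \<in> space M \<Longrightarrow> cmod (F n z) \<le> B"
    and lim: "\<And>z. z \<in> space M \<Longrightarrow> (\<lambda>n. F n z) \<longlonglongrightarrow> f z"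
    and f: "f \<in> borel_measurable M"
  shows "integrable M f" and "(\<lambda>n. LINT z|M. F n z) \<longlonglongrightarrow> (LINT z|M. f z)"
proof -
  interpret finite_measure M by fact
  have "integrable M (\<lambda>_. B)" by simp
  moreover have "AE z in M. (\<lambda>n. F n z) \<longlonglongrightarrow> f z" "\<And>n. AE z in M. cmod (F n z) \<le> B"
    by (rule AE_I2, erule lim) (rule AE_I2, erule B)
  ultimately show "integrable M f" "(\<lambda>n. LINT z|M. F n z) \<longlonglongrightarrow> (LINT z|M. f z)"
    by (rule integrable_dominated_convergence[OF f F] integral_dominated_convergence[OF f F])+
qed

text \<open>The functions with equal integrals under both measures satisfy the closure conditions of
  \<open>bounded_class_indicator\<close>, so agreement on the characters forces agreement on every
  measurable set.\<close>

lemma torus_eqI: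
  fixes M :: "('n::finite \<Rightarrow> complex) measure"
  assumes "finite_measure M" and sets: "sets M = sets torus"
    and char: "\<And>m. (LINT z|M. character m z) = (LINT z|torus. character m z)"
  shows "M = torus"
proof -
  interpret M: finite_measure M by fact
  interpret torus: prob_space "torus :: ('n \<Rightarrow> complex) measure" by (rule prob_space_torus)
  have space: "space M = space torus"
    using sets by (rule sets_eq_imp_space_eq)
  define C where "C f \<longleftrightarrow> integrable M f \<and> integrable torus f \<and>
    (LINT z|M. f z) = (LINT z|torus. f z)" for f :: "_ \<Rightarrow> complex"
  have "C (indicator A)" if "A \<in> sets torus" for A
  proof (rule bounded_class_indicator[OF _ _ _ _ that])
    show "C (character m)" for m
      unfolding C_def using sets
      by (simp add: char integrable_character M.finite_measure_axioms torus.finite_measure_axioms)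
    show "C (\<lambda>z. f z + g z)" if "C f" "C g" for f g
      using that by (simp add: C_def)
    show "C (\<lambda>z. c * f z)" if "C f" for c f
      using that by (simp add: C_def)
    show "C f" if F: "\<And>n. C (F n)" and B: "\<And>n z. z \<in> space torus \<Longrightarrow> cmod (F n z) \<le> B"
      and lim: "\<And>z. z \<in> space torus \<Longrightarrow> (\<lambda>n. F n z) \<longlonglongrightarrow> f z"
      and f: "f \<in> borel_measurable torus" for F f B
    proof -
      have "integrable N f \<and> (\<lambda>n. LINT z|N. F n z) \<longlonglongrightarrow> (LINT z|N. f z)"
        if N: "finite_measure N" "sets N = sets torus" "\<And>n. integrable N (F n)" for N
      proof -
        have sp: "space N = space torus"
          using N(2) by (rule sets_eq_imp_space_eq)
        have "cmod (F n z) \<le> B" if "z \<in> space N" for n z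
          using that unfolding sp by (rule B)
        moreover have "(\<lambda>n. F n z) \<longlonglongrightarrow> f z" if "z \<in> space N" for z
          using that unfolding sp by (rule lim)
        moreover have "f \<in> borel_measurable N"
          using f N(2) by (simp cong: measurable_cong_sets)
        ultimately show ?thesis
          by (intro conjI bounded_convergence[OF N(1) borel_measurable_integrable[OF N(3)]])
      qed
      note conv = this
      have "integrable M (F n)" "integrable torus (F n)" "(LINT z|M. F n z) = (LINT z|torus. F n z)" for n
        using F[of n] by (simp_all add: C_def)
      with conv[OF M.finite_measure_axioms sets] conv[OF torus.finite_measure_axioms refl]
      show ?thesis
        unfolding C_def by (auto intro: LIMSEQ_unique)
    qed
  qed
  then have C: "(LINT z|M. indicator A z :: complex) = (LINT z|torus. indicator A z)"
    if "A \<in> sets torus" for A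
    using that by (simp add: C_def)
  have ind: "(LINT z|N. indicator A z :: complex) = of_real (Sigma_Algebra.measure N A)"
    if "A \<in> sets N" for N and A :: "('n \<Rightarrow> complex) set"
  proof -
    have "(LINT z|N. indicator A z :: complex) = (LINT z|N. complex_of_real (indicat_real A z))"
      by (simp only: of_real_indicator)
    also have "\<dots> = of_real (LINT z|N. indicat_real A z)"
      by (rule integral_complex_of_real)
    also have "(LINT z|N. indicat_real A z) = Sigma_Algebra.measure N A"
      using sets.sets_into_space[OF that] by (simp add: Int_absorb2)
    finally show ?thesis .
  qed
  show ?thesis
  proof (rule measure_eqI[OF sets])
    fix A assume "A \<in> sets M"
    then show "emeasure M A = emeasure torus A"
      using C[of A] ind[of A M] ind[of A torus]
      by (simp add: sets M.emeasure_eq_measure torus.emeasure_eq_measure)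
  qed
qed

section \<open>Maps that preserve Haar measure\<close>

definition haar_preserving :: "(('n::finite \<Rightarrow> complex) \<Rightarrow> 'n \<Rightarrow> complex) \<Rightarrow> bool" where
  "haar_preserving g \<longleftrightarrow> g \<in> measurable torus torus \<and> distr torus torus g = torus"

lemma measurable_torusI:
  assumes "\<And>i. (\<lambda>z. g z i) \<in> borel_measurable M" "\<And>z i. z \<in> space M \<Longrightarrow> cmod (g z i) = 1"
  shows "g \<in> measurable M torus"
  unfolding torus_def
proof (rule measurable_PiM_single')
  have "(\<lambda>z. g z i) \<in> measurable M (restrict_space borel (sphere 0 1))" for i
    using assms by (auto intro!: measurable_restrict_space2)
  then show "(\<lambda>z. g z i) \<in> measurable M circle" for i
    by (simp add: circle_def cong: measurable_cong_sets)
  show "(\<lambda>z i. g z i) \<in> space M \<rightarrow> (\<Pi>\<^sub>E i\<in>UNIV. space circle)"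
    using assms by (auto simp: space_circle)
qed

text \<open>Uniqueness of Fourier coefficients applies to the image measure. A rotation only
  multiplies a character by a scalar, and a power map with exponent \<open>s \<noteq> 0\<close>
  turns the index \<open>m\<close> into \<open>s * m\<close>, which vanishes only with
  \<open>m\<close>; both are thus covered.\<close>

lemma haar_preservingI:
  assumes g: "g \<in> measurable torus torus"
    and char: "\<And>m. (LINT z|torus. character m (g z)) = (if m = (\<lambda>_. 0) then 1 else 0)"
  shows "haar_preserving g"
proof -
  interpret prob_space torus by (rule prob_space_torus)
  have "distr torus torus g = torus"
  proof (rule torus_eqI)
    show "finite_measure (distr torus torus g)"
      by (rule finite_measure_distr[OF g])
    show "(LINT z|distr torus torus g. character m z) = (LINT z|torus. character m z)" for m
      by (simp add: integral_distr[OF g] char integral_character)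
  qed simp
  then show ?thesis using g by (simp add: haar_preserving_def)
qed

lemma haar_preserving_rotation:
  assumes w: "w \<in> space torus"
  shows "haar_preserving (\<lambda>z i. w i * z i)"
proof (rule haar_preservingI)
  show "(\<lambda>z i. w i * z i) \<in> measurable torus torus"
    using w by (intro measurable_torusI) (auto simp: space_torus norm_mult)
  show "(LINT z|torus. character m (\<lambda>i. w i * z i)) = (if m = (\<lambda>_. 0) then 1 else 0)" for m
    by (simp add: character_mult integral_character)
qed

lemma character_powi: "character m (\<lambda>i. z i powi s) = character (\<lambda>i. s * m i) z"
  by (simp add: character_def power_int_mult)

lemma haar_preserving_powi:
  assumes "s \<noteq> 0"
  shows "haar_preserving (\<lambda>z i. z i powi s)"
proof (rule haar_preservingI)
  show "(\<lambda>z i. z i powi s) \<in> measurable torus torus"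
    unfolding power_int_def by (intro measurable_torusI) (auto simp: space_torus norm_power norm_inverse)
  show "(LINT z|torus. character m (\<lambda>i. z i powi s)) = (if m = (\<lambda>_. 0) then 1 else 0)" for m
    using assms by (simp add: character_powi integral_character fun_eq_iff)
qed

section \<open>Density in $L^2$\<close>

lemma L2_torus_cases:
  obtains f where "sq_integrable f" "x = abs_L2_torus f"
  by (induction x rule: L2_torus.abs_induct) auto

lemma abs_L2_torus_eq_iff:
  assumes "sq_integrable f" "sq_integrable g"
  shows "abs_L2_torus f = abs_L2_torus g \<longleftrightarrow> (AE z in torus. f z = g z)"
  using Quotient_rel[OF Quotient_L2_torus, of f g] assms by simp

lemma scaleC_abs: "sq_integrable f \<Longrightarrow> scaleC c (abs_L2_torus f) = abs_L2_torus (\<lambda>z. c * f z)"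
  by (simp add: scaleC.abs_eq)

lemma plus_abs:
  "sq_integrable f \<Longrightarrow> sq_integrable g \<Longrightarrow>
    abs_L2_torus f + abs_L2_torus g = abs_L2_torus (\<lambda>z. f z + g z)"
  by (simp add: plus_L2_torus.abs_eq)

lemma minus_abs:
  "sq_integrable f \<Longrightarrow> sq_integrable g \<Longrightarrow>
    abs_L2_torus f - abs_L2_torus g = abs_L2_torus (\<lambda>z. f z - g z)"
  using plus_abs[of f "\<lambda>z. - 1 * g z"] sq_integrable_cmult[of g "- 1"]
  by (simp add: minus_L2_torus_def uminus_L2_torus_def scaleC_abs)

lemma cinner_abs:
  "sq_integrable f \<Longrightarrow> sq_integrable g \<Longrightarrow>
    cinner (abs_L2_torus f) (abs_L2_torus g) = (LINT z|torus. f z * cnj (g z))"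
  by (simp add: cinner.abs_eq)

lemma monom_e_abs: "monom_e m = abs_L2_torus (character m)"
  by (simp add: monom_e.abs_eq character_def[abs_def])

lemma norm_abs:
  assumes "sq_integrable f"
  shows "norm (abs_L2_torus f) = sqrt (LINT z|torus. (cmod (f z))\<^sup>2)"
  using assms
  by (simp add: norm_eq_sqrt_inner inner_L2_torus_def cinner_abs complex_norm_square[symmetric]
      flip: of_real_power)

lemma cinner_add_left: "cinner (x + y) z = cinner x z + cinner y z"
  by transfer (simp add: distrib_right integrable_mult_cnj)

lemma cinner_scaleC_left: "cinner (scaleC c x) y = c * cinner x y"
  by transfer (simp add: mult.assoc)

lemma cinner_commute: "cinner x y = cnj (cinner y x)"
  by transfer (simp add: mult.commute flip: Bochner_Integration.integral_cnj)

lemma cinner_add_right: "cinner x (y + z) = cinner x y + cinner x z"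
  by (subst (1 2 3) cinner_commute) (simp add: cinner_add_left)

lemma cinner_scaleC_right: "cinner x (scaleC c y) = cnj c * cinner x y"
  by (subst (1 2) cinner_commute) (simp add: cinner_scaleC_left)

lemma cinner_self: "cinner x x = complex_of_real ((norm x)\<^sup>2)"
proof -
  have "Im (cinner x x) = 0"
    using arg_cong[OF cinner_commute[of x x], of Im] by simp
  then show ?thesis
    by (simp add: complex_eq_iff power2_norm_eq_inner inner_L2_torus_def)
qed

lemma norm_scaleC: "norm (scaleC c x) = cmod c * norm x"
proof -
  have "cnj c * c = (complex_of_real (cmod c))\<^sup>2"
    using complex_norm_square[of c] by (simp add: mult.commute)
  then have "complex_of_real ((norm (scaleC c x))\<^sup>2) = complex_of_real ((cmod c * norm x)\<^sup>2)"
    unfolding cinner_self[symmetric] cinner_scaleC_left cinner_scaleC_right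
    by (simp add: cinner_self power_mult_distrib flip: mult.assoc)
  then show ?thesis
    unfolding of_real_eq_iff by (rule power2_eq_imp_eq) simp_all
qed

lemma norm_cinner_le: "cmod (cinner x y) \<le> norm x * norm y"
proof -
  \<comment> \<open>Multiplying \<open>x\<close> by this number of modulus at most 1 makes the inner
    product real and nonnegative, which reduces the claim to the real Cauchy-Schwarz
    inequality.\<close>
  define c where "c = cnj (sgn (cinner x y))"
  have "c * cinner x y = complex_of_real (cmod (cinner x y))"
  proof (cases "cinner x y = 0")
    case False
    have "c * cinner x y = c * (complex_of_real (cmod (cinner x y)) * sgn (cinner x y))"
      using False by (simp add: sgn_div_norm scaleR_conv_of_real)
    also have "\<dots> = complex_of_real (cmod (cinner x y)) * (sgn (cinner x y) * cnj (sgn (cinner x y)))"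
      by (simp add: c_def mult_ac)
    also have "sgn (cinner x y) * cnj (sgn (cinner x y)) = 1"
      using complex_norm_square[of "sgn (cinner x y)"] False by (simp add: norm_sgn)
    finally show ?thesis by simp
  qed simp
  then have "cmod (cinner x y) = inner (scaleC c x) y"
    by (simp add: inner_L2_torus_def cinner_scaleC_left)
  also have "\<dots> \<le> norm (scaleC c x) * norm y"
    by (rule norm_cauchy_schwarz)
  also have "\<dots> \<le> 1 * norm x * norm y"
    unfolding norm_scaleC by (intro mult_right_mono) (simp_all add: c_def norm_sgn)
  finally show ?thesis by simp
qed

lemma bounded_linear_cinner_left: "bounded_linear (\<lambda>x. cinner x y)"
proof (rule bounded_linear_intro[where K = "norm y"])
  show "cinner (r *\<^sub>R x) y = r *\<^sub>R cinner x y" for r x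
    by (simp add: scaleR_L2_torus_def cinner_scaleC_left scaleR_conv_of_real)
qed (simp_all add: cinner_add_left norm_cinner_le)

lemma bounded_linear_scaleC: "bounded_linear (scaleC c :: 'n::finite L2_torus \<Rightarrow> 'n L2_torus)"
proof (rule bounded_linear_intro[where K = "cmod c"])
  show "scaleC c (x + y) = scaleC c x + scaleC c y" for x y :: "'n L2_torus"
    by transfer (auto simp: distrib_left sq_integrable_add sq_integrable_cmult)
  show "scaleC c (r *\<^sub>R x) = r *\<^sub>R scaleC c x" for r and x :: "'n L2_torus"
    unfolding scaleR_L2_torus_def
    by transfer (auto simp: mult.left_commute sq_integrable_cmult)
qed (simp add: norm_scaleC mult.commute)

section \<open>Dominated convergence and density\<close>

lemma sq_integrable_bounded:
  assumes "f \<in> borel_measurable torus" "AE z in torus. cmod (f z) \<le> B"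
  shows "sq_integrable f"
proof -
  interpret prob_space torus by (rule prob_space_torus)
  have "integrable torus (\<lambda>z. (cmod (f z))\<^sup>2)"
  proof (rule integrable_const_bound[of _ "B\<^sup>2"])
    show "AE z in torus. norm ((cmod (f z))\<^sup>2) \<le> B\<^sup>2"
      using assms(2) by eventually_elim (simp add: power_mono)
  qed (use assms(1) in measurable)
  then show ?thesis
    using assms(1) by (simp add: sq_integrable_def)
qed

lemma sq_integrable_character: "sq_integrable (character m)"
  by (rule sq_integrable_bounded[of _ 1]) (auto simp: norm_character intro: AE_I2)

text \<open>The limit inherits the bound \<open>g\<close>, so the squared distances to it are
  dominated by \<open>4 * (g z)\<^sup>2\<close>, and ordinary dominated convergence applies to their
  integrals.\<close>

lemma L2_dominated_convergence:
  fixes f :: "('n::finite \<Rightarrow> complex) \<Rightarrow> complex"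
  assumes F: "\<And>n. F n \<in> borel_measurable torus" and f: "f \<in> borel_measurable torus"
    and g: "integrable torus (\<lambda>z. (g z)\<^sup>2)"
    and le: "\<And>n z. z \<in> space torus \<Longrightarrow> cmod (F n z) \<le> g z"
    and lim: "\<And>z. z \<in> space torus \<Longrightarrow> (\<lambda>n. F n z) \<longlonglongrightarrow> f z"
  shows "sq_integrable f" "\<And>n. sq_integrable (F n)"
    and "(\<lambda>n. abs_L2_torus (F n)) \<longlonglongrightarrow> abs_L2_torus f"
proof -
  have sq: "sq_integrable h" if h: "h \<in> borel_measurable torus"
    "\<And>z. z \<in> space torus \<Longrightarrow> cmod (h z) \<le> g z" for h
  proof -
    have "integrable torus (\<lambda>z. (cmod (h z))\<^sup>2)"
    proof (rule Bochner_Integration.integrable_bound[OF g])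
      show "AE z in torus. norm ((cmod (h z))\<^sup>2) \<le> norm ((g z)\<^sup>2)"
        by (rule AE_I2) (simp add: power_mono h(2))
    qed (use h(1) in measurable)
    then show ?thesis
      using h(1) by (simp add: sq_integrable_def)
  qed
  show sqF: "sq_integrable (F n)" for n
    by (rule sq[OF F le])
  have fg: "cmod (f z) \<le> g z" if "z \<in> space torus" for z
    using le[OF that] by (intro LIMSEQ_le_const2[OF tendsto_norm[OF lim[OF that]]]) auto
  show sqf: "sq_integrable f"
    by (rule sq[OF f fg])
  have "(\<lambda>n. LINT z|torus. (cmod (F n z - f z))\<^sup>2) \<longlonglongrightarrow> (LINT z|(torus :: ('n \<Rightarrow> complex) measure). 0)"
  proof (rule integral_dominated_convergence)
    show "integrable torus (\<lambda>z. 4 * (g z)\<^sup>2)"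
      using g by simp
    show "AE z in torus. (\<lambda>n. (cmod (F n z - f z))\<^sup>2) \<longlonglongrightarrow> 0"
    proof (rule AE_I2)
      fix z :: "'n \<Rightarrow> complex" assume "z \<in> space torus"
      then have "(\<lambda>n. cmod (F n z - f z)) \<longlonglongrightarrow> 0"
        using lim by (intro tendsto_norm_zero) (simp add: LIM_zero_iff)
      from tendsto_power[OF this, of 2] show "(\<lambda>n. (cmod (F n z - f z))\<^sup>2) \<longlonglongrightarrow> 0" by simp
    qed
    show "AE z in torus. norm ((cmod (F n z - f z))\<^sup>2) \<le> 4 * (g z)\<^sup>2" for n
    proof (rule AE_I2)
      fix z :: "'n \<Rightarrow> complex" assume z: "z \<in> space torus"
      have "cmod (F n z - f z) \<le> 2 * g z"
        using norm_triangle_ineq4[of "F n z" "f z"] le[OF z, of n] fg[OF z] by linarith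
      then have "(cmod (F n z - f z))\<^sup>2 \<le> (2 * g z)\<^sup>2"
        by (rule power_mono) simp
      then show "norm ((cmod (F n z - f z))\<^sup>2) \<le> 4 * (g z)\<^sup>2"
        by (simp add: power_mult_distrib)
    qed
  qed (use F f in measurable)
  then have "(\<lambda>n. sqrt (LINT z|torus. (cmod (F n z - f z))\<^sup>2)) \<longlonglongrightarrow> sqrt 0"
    by (intro tendsto_real_sqrt) simp
  moreover have "sqrt (LINT z|torus. (cmod (F n z - f z))\<^sup>2) = norm (abs_L2_torus (F n) - abs_L2_torus f)" for n
  proof -
    have "sq_integrable (\<lambda>z. F n z - f z)"
      using sq_integrable_add[OF sqF[of n] sq_integrable_cmult[OF sqf, of "- 1"]] by simp
    then show ?thesis
      by (simp add: minus_abs sqF sqf norm_abs)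
  qed
  ultimately show "(\<lambda>n. abs_L2_torus (F n)) \<longlonglongrightarrow> abs_L2_torus f"
    by (simp add: LIM_zero_iff tendsto_norm_zero_iff)
qed

text \<open>Serves as an induction principle: a closed linear condition on \<open>x\<close> need
  only be checked on the characters. Indicators come from \<open>bounded_class_indicator\<close>,
  simple functions from linearity, and the rest from dominated approximation.\<close>

lemma L2_torus_dense:
  fixes K :: "'n::finite L2_torus set"
  assumes closed: "closed K" and monom: "\<And>m. monom_e m \<in> K"
    and add: "\<And>x y. x \<in> K \<Longrightarrow> y \<in> K \<Longrightarrow> x + y \<in> K"
    and scale: "\<And>c x. x \<in> K \<Longrightarrow> scaleC c x \<in> K"
  shows "x \<in> K"
proof -
  define C where "C f \<longleftrightarrow> sq_integrable f \<and> abs_L2_torus f \<in> K" for f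
  have C_add: "C (\<lambda>z. f z + g z)" if "C f" "C g" for f g
    using that add by (auto simp: C_def sq_integrable_add simp flip: plus_abs)
  have C_scale: "C (\<lambda>z. c * f z)" if "C f" for c f
    using that scale by (auto simp: C_def sq_integrable_cmult simp flip: scaleC_abs)
  have C_lim: "C f" if "\<And>n. C (F n)" "f \<in> borel_measurable torus" "integrable torus (\<lambda>z. (g z)\<^sup>2)"
    "\<And>n z. z \<in> space torus \<Longrightarrow> cmod (F n z) \<le> g z"
    "\<And>z. z \<in> space torus \<Longrightarrow> (\<lambda>n. F n z) \<longlonglongrightarrow> f z" for F f g
  proof -
    have F: "F n \<in> borel_measurable torus" for n
      using that(1) by (simp add: C_def sq_integrable_def)
    have sq: "sq_integrable f"
      by (rule L2_dominated_convergence(1)[where F = F and g = g]) (fact F that)+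
    have lim: "(\<lambda>n. abs_L2_torus (F n)) \<longlonglongrightarrow> abs_L2_torus f"
      by (rule L2_dominated_convergence(3)[where g = g]) (fact F that)+
    have "abs_L2_torus (F n) \<in> K" for n
      using that(1) by (simp add: C_def)
    from closed_sequentially[OF closed this lim] sq show ?thesis
      by (simp add: C_def)
  qed
  interpret prob_space "torus :: ('n \<Rightarrow> complex) measure" by (rule prob_space_torus)
  have C_indicator: "C (indicator A)" if "A \<in> sets torus" for A
  proof (rule bounded_class_indicator[OF _ _ _ _ that])
    show "C (character m)" for m
      using monom[of m] by (simp add: C_def sq_integrable_character monom_e_abs)
    show "C f" if "\<And>n. C (F n)" "\<And>n z. z \<in> space torus \<Longrightarrow> cmod (F n z) \<le> B"
      "\<And>z. z \<in> space torus \<Longrightarrow> (\<lambda>n. F n z) \<longlonglongrightarrow> f z" "f \<in> borel_measurable torus" for F f B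
      by (rule C_lim[where g = "\<lambda>_. B", OF that(1,4) _ that(2,3)]) simp_all
  qed (fact C_add C_scale)+
  have C_0: "C (\<lambda>_. 0)"
    using C_scale[OF C_indicator[OF sets.empty_sets], of 0] by simp
  have C_simple: "C h" if h: "simple_function torus h" for h :: "_ \<Rightarrow> complex"
  proof (rule C_lim[where F = "\<lambda>_ z. \<Sum>y\<in>h ` space torus. y * indicator (h -` {y} \<inter> space torus) z"])
    \<comment> \<open>\<open>h\<close> equals this sum over its level sets only on the torus; the
      constant sequence in \<open>C_lim\<close> passes from the sum to \<open>h\<close>.\<close>
    let ?H = "\<lambda>z. \<Sum>y\<in>h ` space torus. y * indicator (h -` {y} \<inter> space torus) z"
    have fin: "finite (h ` space torus)"
      using h by (rule simple_functionD)
    have eq: "?H z = h z" if "z \<in> space torus" for z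
    proof -
      have "?H z = (\<Sum>y\<in>h ` space torus. if h z = y then y else 0)"
        using that by (intro sum.cong) (auto simp: indicator_def)
      then show ?thesis
        using fin that by simp
    qed
    have "C (\<lambda>z. \<Sum>y\<in>Y. y * indicator (h -` {y} \<inter> space torus) z)" if "finite Y" for Y
      using that
    proof induction
      case (insert y Y)
      then show ?case
        unfolding sum.insert[OF insert.hyps]
        using simple_functionD(2)[OF h] by (intro C_add C_scale C_indicator)
    qed (simp add: C_0)
    then show "C ?H"
      using fin by blast
    show meas: "h \<in> borel_measurable torus"
      by (rule borel_measurable_simple_function[OF h])
    show "integrable torus (\<lambda>z. (cmod (h z))\<^sup>2)"
    proof (rule integrable_const_bound[of _ "(Max (cmod ` h ` space torus))\<^sup>2"])
      show "AE z in torus. norm ((cmod (h z))\<^sup>2) \<le> (Max (cmod ` h ` space torus))\<^sup>2"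
        using fin by (intro AE_I2) (auto intro!: power_mono Max_ge)
    qed (use meas in measurable)
    show "cmod (?H z) \<le> cmod (h z)" if "z \<in> space torus" for z
      using eq[OF that] by simp
    show "(\<lambda>n. ?H z) \<longlonglongrightarrow> h z" if "z \<in> space torus" for z
      using eq[OF that] by simp
  qed
  obtain f where f: "sq_integrable f" "x = abs_L2_torus f"
    by (rule L2_torus_cases)
  then have meas: "f \<in> borel_measurable torus" and int: "integrable torus (\<lambda>z. (cmod (f z))\<^sup>2)"
    by (simp_all add: sq_integrable_def)
  \<comment> \<open>The approximating simple functions stay within \<open>2 * cmod (f z)\<close>,
    whence the dominating function below.\<close>
  obtain F where F: "\<And>n. simple_function torus (F n)"
    "\<And>z. z \<in> space torus \<Longrightarrow> (\<lambda>n. F n z) \<longlonglongrightarrow> f z"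
    "\<And>n z. z \<in> space torus \<Longrightarrow> dist (F n z) 0 \<le> 2 * dist (f z) 0"
    using borel_measurable_implies_sequence_metric[OF meas, of 0] by blast
  have "C f"
  proof (rule C_lim)
    show "C (F n)" for n
      by (rule C_simple[OF F(1)])
    show "integrable torus (\<lambda>z. (2 * cmod (f z))\<^sup>2)"
      using int by (simp add: power_mult_distrib)
    show "cmod (F n z) \<le> 2 * cmod (f z)" if "z \<in> space torus" for n z
      using F(3)[OF that] by simp
  qed (fact meas F(2))+
  then show ?thesis
    by (simp add: C_def f)
qed

section \<open>Uniqueness from values on the characters\<close>

lemma bounded_clinear_eqI:
  assumes "bounded_clinear S" "bounded_clinear T" and eq: "\<And>m. S (monom_e m) = T (monom_e m)"
  shows "S = T"
proof
  fix x
  have S: "bounded_linear S" and T: "bounded_linear T"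
    using assms by (simp_all add: bounded_clinear_def)
  have "x \<in> {x. S x = T x}"
  proof (rule L2_torus_dense)
    show "closed {x. S x = T x}"
      using S T by (intro closed_Collect_eq linear_continuous_on)
  qed (use assms S T in \<open>auto simp: bounded_clinear_def linear_simps\<close>)
  then show "S x = T x" by simp
qed

lemma cinner_monom_eqI:
  assumes "\<And>m. cinner x (monom_e m) = cinner y (monom_e m)"
  shows "x = y"
proof -
  \<comment> \<open>The set is the orthogonal complement of \<open>x - y\<close>. It contains all
    characters, hence every vector, in particular \<open>x - y\<close> itself.\<close>
  have "x - y \<in> {u. cinner u x = cinner u y}"
  proof (rule L2_torus_dense)
    show "closed {u. cinner u x = cinner u y}"
      by (intro closed_Collect_eq linear_continuous_on bounded_linear_cinner_left)
    show "monom_e m \<in> {u. cinner u x = cinner u y}" for m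
      using arg_cong[OF assms[of m], of cnj] by (simp flip: cinner_commute)
  qed (simp_all add: cinner_add_left cinner_scaleC_left)
  then have "cinner (x - y) (x - y) = 0"
    using cinner_add_right[of "x - y" "x - y" y] by simp
  then show ?thesis
    by (simp add: cinner_self)
qed

section \<open>Composition with measure preserving maps\<close>

lemma bounded_clinearI:
  assumes "\<And>x y. S (x + y) = S x + S y" "\<And>c x. S (scaleC c x) = scaleC c (S x)"
    "\<And>x. norm (S x) \<le> norm x * K"
  shows "bounded_clinear S"
  unfolding bounded_clinear_def
  using assms by (auto intro!: bounded_linear_intro[where K = K] simp: scaleR_L2_torus_def)

lemma bounded_clinear_compose:
  "bounded_clinear S \<Longrightarrow> bounded_clinear T \<Longrightarrow> bounded_clinear (\<lambda>x. S (T x))"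
  unfolding bounded_clinear_def using bounded_linear_compose[of S T] by auto

lemma bounded_clinear_add: "bounded_clinear S \<Longrightarrow> S (x + y) = S x + S y"
  by (simp add: bounded_clinear_def linear_simps)

lemma bounded_clinear_scaleC: "bounded_clinear S \<Longrightarrow> S (scaleC c x) = scaleC c (S x)"
  by (simp add: bounded_clinear_def)

lemma sum_abs:
  assumes "finite A" "\<And>a. a \<in> A \<Longrightarrow> sq_integrable (f a)"
  shows "sq_integrable (\<lambda>z. \<Sum>a\<in>A. f a z) \<and>
    (\<Sum>a\<in>A. abs_L2_torus (f a)) = abs_L2_torus (\<lambda>z. \<Sum>a\<in>A. f a z)"
  using assms
proof (induction rule: finite_induct)
  case empty
  show ?case
    by (simp add: zero_L2_torus.abs_eq sq_integrable_def)
next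
  case (insert a A)
  then show ?case
    by (simp add: plus_abs sq_integrable_add)
qed

lemma haar_preserving_measurable: "haar_preserving g \<Longrightarrow> g \<in> measurable torus torus"
  by (simp add: haar_preserving_def)

lemma integral_haar_preserving:
  fixes f :: "_ \<Rightarrow> 'b::{banach, second_countable_topology}"
  assumes "haar_preserving g" "f \<in> borel_measurable torus"
  shows "(LINT z|torus. f (g z)) = (LINT z|torus. f z)"
  using integral_distr[of g torus torus f] assms by (simp add: haar_preserving_def)

lemma AE_haar_preserving:
  assumes "haar_preserving g" "{z \<in> space torus. P z} \<in> sets torus"
  shows "(AE z in torus. P (g z)) \<longleftrightarrow> (AE z in torus. P z)"
  using AE_distr_iff[of g torus torus P] assms by (metis haar_preserving_def)

lemma sq_integrable_cong:
  assumes "\<And>z. z \<in> space torus \<Longrightarrow> f z = g z"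
  shows "sq_integrable f \<longleftrightarrow> sq_integrable g"
  using assms
  by (auto simp: sq_integrable_def cong: measurable_cong Bochner_Integration.integrable_cong)

lemma sq_integrable_haar_preserving_iff:
  assumes g: "haar_preserving g" and f: "f \<in> borel_measurable torus"
  shows "sq_integrable (\<lambda>z. f (g z)) \<longleftrightarrow> sq_integrable f"
proof -
  have "integrable torus (\<lambda>z. (cmod (f (g z)))\<^sup>2) \<longleftrightarrow> integrable torus (\<lambda>z. (cmod (f z))\<^sup>2)"
    using integrable_distr_eq[of g torus torus "\<lambda>z. (cmod (f z))\<^sup>2"] assms
    by (simp add: haar_preserving_def)
  then show ?thesis
    using measurable_compose[OF haar_preserving_measurable[OF g] f] f by (simp add: sq_integrable_def)
qed

lemma sq_integrable_measurable: "sq_integrable f \<Longrightarrow> f \<in> borel_measurable torus"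
  by (simp add: sq_integrable_def)

text \<open>Composition descends to classes because a measure preserving map pulls null sets back to
  null sets; all other maps \<open>g\<close> get the operator 0.\<close>

lift_definition comp_op :: "(('n::finite \<Rightarrow> complex) \<Rightarrow> 'n \<Rightarrow> complex) \<Rightarrow> 'n L2_torus \<Rightarrow> 'n L2_torus"
  is "\<lambda>g f z. if haar_preserving g then f (g z) else 0"
proof -
  fix g :: "('n \<Rightarrow> complex) \<Rightarrow> 'n \<Rightarrow> complex" and f h :: "('n \<Rightarrow> complex) \<Rightarrow> complex"
  assume fh: "sq_integrable f \<and> sq_integrable h \<and> (AE z in torus. f z = h z)"
  then have [measurable]: "f \<in> borel_measurable torus" "h \<in> borel_measurable torus"
    by (simp_all add: sq_integrable_def)
  have "{z \<in> space torus. f z = h z} \<in> sets torus"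
    by measurable
  with fh show "sq_integrable (\<lambda>z. if haar_preserving g then f (g z) else 0) \<and>
    sq_integrable (\<lambda>z. if haar_preserving g then h (g z) else 0) \<and>
    (AE z in torus. (if haar_preserving g then f (g z) else 0) = (if haar_preserving g then h (g z) else 0))"
    by (cases "haar_preserving g")
      (simp_all add: AE_haar_preserving[where P = "\<lambda>z. f z = h z"]
        sq_integrable_haar_preserving_iff, simp add: sq_integrable_def)
qed

lemma comp_op_abs:
  "haar_preserving g \<Longrightarrow> sq_integrable f \<Longrightarrow> comp_op g (abs_L2_torus f) = abs_L2_torus (\<lambda>z. f (g z))"
  by (simp add: comp_op.abs_eq)

lemma cinner_comp_op:
  assumes "haar_preserving g"
  shows "cinner (comp_op g x) (comp_op g y) = cinner x y"
  using assms
proof transfer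
  fix g :: "('a \<Rightarrow> complex) \<Rightarrow> 'a \<Rightarrow> complex" and f h :: "('a \<Rightarrow> complex) \<Rightarrow> complex"
  assume "haar_preserving g" and sq: "sq_integrable f \<and> sq_integrable f \<and> (AE z in torus. f z = f z)"
    "sq_integrable h \<and> sq_integrable h \<and> (AE z in torus. h z = h z)"
  then have "(\<lambda>z. f z * cnj (h z)) \<in> borel_measurable torus"
    by (intro borel_measurable_integrable integrable_mult_cnj) simp_all
  from integral_haar_preserving[OF \<open>haar_preserving g\<close> this]
  show "(LINT z|torus. (if haar_preserving g then f (g z) else 0) *
      cnj (if haar_preserving g then h (g z) else 0)) = (LINT z|torus. f z * cnj (h z))"
    using \<open>haar_preserving g\<close> by simp
qed

lemma norm_comp_op: "haar_preserving g \<Longrightarrow> norm (comp_op g x) = norm x"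
  by (simp add: norm_eq_sqrt_inner inner_L2_torus_def cinner_comp_op)

lemma bounded_clinear_comp_op:
  assumes "haar_preserving g"
  shows "bounded_clinear (comp_op g)"
proof (rule bounded_clinearI)
  fix x y :: "'a L2_torus" and c
  obtain f h where fh: "sq_integrable f" "x = abs_L2_torus f" "sq_integrable h" "y = abs_L2_torus h"
    by (metis L2_torus_cases)
  then have "sq_integrable (\<lambda>z. f (g z))" "sq_integrable (\<lambda>z. h (g z))"
    using assms by (simp_all add: sq_integrable_haar_preserving_iff sq_integrable_measurable)
  then show "comp_op g (x + y) = comp_op g x + comp_op g y"
    and "comp_op g (scaleC c x) = scaleC c (comp_op g x)"
    using assms fh by (simp_all add: plus_abs scaleC_abs comp_op_abs sq_integrable_add sq_integrable_cmult)
  show "norm (comp_op g x) \<le> norm x * 1"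
    by (simp add: norm_comp_op assms)
qed

text \<open>An isometry is injective. This allows \<open>powi_op\<close> to be cancelled in the
  identities for the root average.\<close>

lemma comp_op_eq_iff: "haar_preserving g \<Longrightarrow> comp_op g x = comp_op g y \<longleftrightarrow> x = y"
  using norm_comp_op[of g "x - y"] bounded_clinear_comp_op[of g]
  by (auto simp: bounded_clinear_def linear_simps)

lemma comp_op_comp_op:
  assumes "haar_preserving g" "haar_preserving h" "haar_preserving (\<lambda>z. h (g z))"
  shows "comp_op g (comp_op h x) = comp_op (\<lambda>z. h (g z)) x"
proof -
  obtain f where "sq_integrable f" "x = abs_L2_torus f"
    by (rule L2_torus_cases)
  then show ?thesis
    using assms by (simp add: comp_op_abs sq_integrable_haar_preserving_iff sq_integrable_measurable)
qed

lemma comp_op_rotation_monom: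
  assumes "w \<in> space torus"
  shows "comp_op (\<lambda>z i. w i * z i) (monom_e m) = scaleC (character m w) (monom_e m)"
  using haar_preserving_rotation[OF assms]
  by (simp add: monom_e_abs comp_op_abs sq_integrable_character scaleC_abs character_mult)

lemma comp_op_powi_monom:
  "s \<noteq> 0 \<Longrightarrow> comp_op (\<lambda>z i. z i powi s) (monom_e m) = monom_e (\<lambda>i. s * m i)"
  by (simp add: monom_e_abs comp_op_abs sq_integrable_character haar_preserving_powi
      character_powi[abs_def])

section \<open>The operator $V_k$\<close>

text \<open>For \<open>k > 0\<close>, the kernel of \<open>z \<mapsto> z powi (- k)\<close> on the
  torus; every fibre of this map over the torus is one of its cosets.\<close>

definition unity_vecs :: "nat \<Rightarrow> ('n::finite \<Rightarrow> complex) set" where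
  "unity_vecs k = {u. \<forall>i. u i ^ k = 1}"

lemma finite_unity_vecs: "k > 0 \<Longrightarrow> finite (unity_vecs k :: ('n::finite \<Rightarrow> complex) set)"
proof -
  assume "k > 0"
  then have "finite (PiE (UNIV :: 'n set) (\<lambda>_. {z::complex. z ^ k = 1}))"
    by (intro finite_PiE finite_roots_unity) auto
  also have "PiE (UNIV :: 'n set) (\<lambda>_. {z::complex. z ^ k = 1}) = unity_vecs k"
    by (auto simp: unity_vecs_def PiE_def Pi_def)
  finally show ?thesis .
qed

lemma one_in_unity_vecs: "(\<lambda>_. 1) \<in> unity_vecs k"
  by (simp add: unity_vecs_def)

lemma card_unity_vecs: "k > 0 \<Longrightarrow> card (unity_vecs k :: ('n::finite \<Rightarrow> complex) set) > 0"
  using finite_unity_vecs[of k] one_in_unity_vecs[of k] by (auto simp: card_gt_0_iff)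

lemma unity_vecs_subset: "k > 0 \<Longrightarrow> unity_vecs k \<subseteq> space torus"
proof
  fix u :: "'a \<Rightarrow> complex" assume "k > 0" "u \<in> unity_vecs k"
  then show "u \<in> space torus"
    using power_eq_1_iff[of "u _" k] by (simp add: unity_vecs_def space_torus)
qed

lemma haar_preserving_unity_vec:
  "k > 0 \<Longrightarrow> u \<in> unity_vecs k \<Longrightarrow> haar_preserving (\<lambda>z i. u i * z i)"
  using unity_vecs_subset[of k] by (intro haar_preserving_rotation) auto

text \<open>If \<open>k\<close> does not divide \<open>m j\<close>, rotating the \<open>j\<close>-th coordinate by a primitive root of unity
  multiplies the sum by a factor different from 1.\<close>

lemma sum_character_unity_vecs:
  fixes m :: "'n::finite \<Rightarrow> int"
  assumes k: "k > 0"
  shows "(\<Sum>u\<in>unity_vecs k. character m u) =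
    (if \<forall>i. int k dvd m i then of_nat (card (unity_vecs k :: ('n \<Rightarrow> complex) set)) else 0)"
proof (cases "\<forall>i. int k dvd m i")
  case True
  have "character m u = 1" if "u \<in> unity_vecs k" for u
  proof -
    have "u i powi m i = 1" for i
    proof -
      from True obtain l where "m i = int k * l" by (auto elim: dvdE)
      then show ?thesis
        using that by (simp add: power_int_mult unity_vecs_def)
    qed
    then show ?thesis by (simp add: character_def)
  qed
  then show ?thesis using True by simp
next
  case False
  then obtain j where j: "\<not> int k dvd m j" by blast
  define w :: complex where "w = cis (2 * pi / real k)"
  have w: "w ^ k = 1" "w \<noteq> 0"
    using k by (simp_all add: w_def Complex.DeMoivre)
  have "w powi m j \<noteq> 1"
  proof
    assume "w powi m j = 1"
    then have "cis (2 * pi * real_of_int (m j) / real k) = 1"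
      by (simp add: w_def cis_power_int mult_ac)
    then obtain l :: int where "2 * pi * real_of_int (m j) / real k = 2 * pi * real_of_int l"
      by (auto simp: complex_eq_iff cos_one_2pi_int mult_ac)
    then have "real_of_int (m j) = real_of_int (int k * l)"
      using k by (simp add: field_simps)
    then show False
      using j by (simp only: of_int_eq_iff) simp
  qed
  define v :: "'n \<Rightarrow> complex" where "v i = (if i = j then w else 1)" for i
  have v: "character m v \<noteq> 1"
  proof -
    have "character m v = (\<Prod>i\<in>UNIV. if i = j then w powi m i else 1)"
      unfolding character_def v_def by (intro prod.cong) auto
    then show ?thesis using \<open>w powi m j \<noteq> 1\<close> by simp
  qed
  have "(\<Sum>u\<in>unity_vecs k. character m u) = (\<Sum>u\<in>unity_vecs k. character m (\<lambda>i. v i * u i))"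
    by (rule sum.reindex_bij_witness[where j = "\<lambda>u i. u i / v i" and i = "\<lambda>u i. v i * u i"])
      (use w in \<open>auto simp: v_def unity_vecs_def power_mult_distrib power_divide\<close>)
  also have "\<dots> = character m v * (\<Sum>u\<in>unity_vecs k. character m u)"
    by (simp add: character_mult sum_distrib_left)
  finally show ?thesis
    using v j by auto
qed

text \<open>The candidate for \<open>V_k\<close> on functions. The fibre of
  \<open>w \<mapsto> w powi (- k)\<close> over \<open>z\<close> is written with the equation
  inverted, and the divisor is the size of the kernel, hence of each fibre over the torus.\<close>

definition root_average :: "nat \<Rightarrow> (('n::finite \<Rightarrow> complex) \<Rightarrow> complex) \<Rightarrow> ('n \<Rightarrow> complex) \<Rightarrow> complex" where
  "root_average k f z = (\<Sum>w | \<forall>i. w i ^ k = inverse (z i). f w) /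
     of_nat (card (unity_vecs k :: ('n \<Rightarrow> complex) set))"

text \<open>Dividing by \<open>z\<close> maps the fibre over \<open>z powi (- k)\<close> bijectively
  onto the kernel. The moving fibre becomes a fixed set of rotations.\<close>

lemma root_average_powi:
  fixes z :: "'n::finite \<Rightarrow> complex"
  assumes "z \<in> space torus"
  shows "root_average k f (\<lambda>i. z i powi (- int k)) =
    (\<Sum>u\<in>unity_vecs k. f (\<lambda>i. u i * z i)) / of_nat (card (unity_vecs k :: ('n \<Rightarrow> complex) set))"
proof -
  have z: "z i \<noteq> 0" for i
    using assms by (auto simp: space_torus dest: spec[of _ i])
  have "(\<Sum>w | \<forall>i. w i ^ k = inverse (z i powi (- int k)). f w) =
      (\<Sum>u\<in>unity_vecs k. f (\<lambda>i. u i * z i))"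
    by (rule sum.reindex_bij_witness[where j = "\<lambda>w i. w i / z i" and i = "\<lambda>u i. u i * z i"])
      (auto simp: z unity_vecs_def power_int_minus power_mult_distrib power_divide)
  then show ?thesis
    by (simp add: root_average_def)
qed

text \<open>With a measurable right inverse \<open>r\<close> of $w \mapsto w^{-k}$ on the circle, the average over the
  roots becomes a sum of rotations of \<open>f\<close> at \<open>r z\<close>.\<close>

lemma measurable_root_average:
  fixes f :: "('n::finite \<Rightarrow> complex) \<Rightarrow> complex"
  assumes f: "f \<in> borel_measurable torus" and k: "k > 0"
  shows "root_average k f \<in> borel_measurable torus"
proof -
  \<comment> \<open>\<open>Arg\<close> is continuous off the nonpositive reals, where it is
    overwritten by the constant \<open>pi\<close> to obtain a Borel function. On the unit circle
    this changes nothing, since \<open>Arg (- 1) = pi\<close>.\<close>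
  define A where "A w = (if w \<in> - \<real>\<^sub>\<le>\<^sub>0 then Arg w else pi)" for w
  define r where "r w = cis (- A w / real k)" for w
  have "A \<in> borel_measurable borel"
    unfolding A_def
    by (intro borel_measurable_continuous_on_if continuous_on_Arg continuous_intros) auto
  moreover have "(\<lambda>t. cis (- t / real k)) \<in> borel_measurable borel"
    using k by (intro borel_measurable_continuous_onI continuous_intros) auto
  ultimately have r_meas: "r \<in> borel_measurable borel"
    unfolding r_def by (rule measurable_compose)
  have r: "r w powi (- int k) = w" if "cmod w = 1" for w
  proof -
    have "A w = Arg w"
      using that Arg_eq_pi[of w]
      by (auto simp: A_def complex_nonpos_Reals_iff cmod_def order.order_iff_strict)
    moreover have "cis (Arg w) = w"
      using that by (metis cis_Arg norm_zero sgn_div_norm inverse_1 scaleR_one zero_neq_one)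
    ultimately show ?thesis
      using k by (simp add: r_def cis_power_int)
  qed
  have meas: "(\<lambda>z i. r (z i)) \<in> measurable torus torus"
    by (intro measurable_torusI measurable_compose[OF _ r_meas]) (simp_all add: r_def)
  have "(\<lambda>z. f (\<lambda>i. u i * r (z i))) \<in> borel_measurable torus" if "u \<in> unity_vecs k" for u
    using measurable_compose[OF measurable_compose[OF meas
          haar_preserving_measurable[OF haar_preserving_unity_vec[OF k that]]] f] .
  then have "(\<lambda>z. (\<Sum>u\<in>unity_vecs k. f (\<lambda>i. u i * r (z i))) /
      of_nat (card (unity_vecs k :: ('n \<Rightarrow> complex) set))) \<in> borel_measurable torus"
    by (intro borel_measurable_divide borel_measurable_sum borel_measurable_const)
  moreover have "(\<Sum>u\<in>unity_vecs k. f (\<lambda>i. u i * r (z i))) /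
      of_nat (card (unity_vecs k :: ('n \<Rightarrow> complex) set)) = root_average k f (\<lambda>i. r (z i) powi (- int k))"
    for z :: "'n \<Rightarrow> complex"
    by (rule root_average_powi[symmetric]) (simp add: space_torus r_def)
  ultimately have "(\<lambda>z. root_average k f (\<lambda>i. r (z i) powi (- int k))) \<in> borel_measurable torus"
    by simp
  then show ?thesis
    by (rule measurable_cong[THEN iffD1, rotated]) (simp add: r space_torus)
qed

text \<open>Since the power map preserves Haar measure, the claim may be checked after composition
  with it, where the root average is a finite sum of rotated copies of \<open>f\<close>.\<close>

lemma sq_integrable_root_average:
  fixes f :: "('n::finite \<Rightarrow> complex) \<Rightarrow> complex"
  assumes f: "sq_integrable f" and k: "k > 0"
  shows "sq_integrable (root_average k f)"
proof -
  have "sq_integrable (\<lambda>z. f (\<lambda>i. u i * z i))" if "u \<in> unity_vecs k" for u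
    using haar_preserving_unity_vec[OF k that] f
    by (simp add: sq_integrable_haar_preserving_iff[where g = "\<lambda>z i. u i * z i"] sq_integrable_measurable)
  then have "sq_integrable (\<lambda>z. (1 / of_nat (card (unity_vecs k :: ('n \<Rightarrow> complex) set))) *
      (\<Sum>u\<in>unity_vecs k. f (\<lambda>i. u i * z i)))"
    by (intro sq_integrable_cmult sum_abs[THEN conjunct1] finite_unity_vecs k)
  then have "sq_integrable (\<lambda>z. root_average k f (\<lambda>i. z i powi (- int k)))"
    by (rule sq_integrable_cong[THEN iffD1, rotated]) (simp add: root_average_powi)
  then show ?thesis
    using k by (simp add: sq_integrable_haar_preserving_iff[OF haar_preserving_powi]
        measurable_root_average sq_integrable_measurable f)
qed

text \<open>Rotations preserve null sets and only finitely many occur, so almost everywhere all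
  rotated values agree at once. The result is carried back through the power map.\<close>

lemma AE_root_average:
  fixes f g :: "('n::finite \<Rightarrow> complex) \<Rightarrow> complex"
  assumes fg: "sq_integrable f" "sq_integrable g" "AE z in torus. f z = g z" and k: "k > 0"
  shows "AE z in torus. root_average k f z = root_average k g z"
proof -
  have [measurable]: "f \<in> borel_measurable torus" "g \<in> borel_measurable torus"
    "root_average k f \<in> borel_measurable torus" "root_average k g \<in> borel_measurable torus"
    using fg k by (simp_all add: sq_integrable_measurable measurable_root_average)
  have "AE z in torus. f (\<lambda>i. u i * z i) = g (\<lambda>i. u i * z i)" if "u \<in> unity_vecs k" for u
  proof (subst AE_haar_preserving[where P = "\<lambda>z. f z = g z"])
    show "haar_preserving (\<lambda>z i. u i * z i)"
      by (rule haar_preserving_unity_vec[OF k that])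
    show "{z \<in> space torus. f z = g z} \<in> sets torus"
      by measurable
  qed (rule fg(3))
  then have "AE z in torus. \<forall>u\<in>unity_vecs k. f (\<lambda>i. u i * z i) = g (\<lambda>i. u i * z i)"
    by (intro AE_finite_allI finite_unity_vecs k)
  then have "AE z in torus. root_average k f (\<lambda>i. z i powi (- int k)) = root_average k g (\<lambda>i. z i powi (- int k))"
  proof (rule AE_mp, intro AE_I2 impI)
    fix z :: "'n \<Rightarrow> complex"
    assume "z \<in> space torus" "\<forall>u\<in>unity_vecs k. f (\<lambda>i. u i * z i) = g (\<lambda>i. u i * z i)"
    then show "root_average k f (\<lambda>i. z i powi (- int k)) = root_average k g (\<lambda>i. z i powi (- int k))"
      by (simp add: root_average_powi)
  qed
  moreover have "{z \<in> space torus. root_average k f z = root_average k g z} \<in> sets torus"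
    by measurable
  ultimately show ?thesis
    using k by (subst (asm) AE_haar_preserving[OF haar_preserving_powi]) simp_all
qed

lift_definition root_average_op :: "nat \<Rightarrow> 'n::finite L2_torus \<Rightarrow> 'n L2_torus"
  is "\<lambda>k f z. if k = 0 then 0 else root_average k f z"
proof -
  fix k and f g :: "('n \<Rightarrow> complex) \<Rightarrow> complex"
  assume "sq_integrable f \<and> sq_integrable g \<and> (AE z in torus. f z = g z)"
  then show "sq_integrable (\<lambda>z. if k = 0 then 0 else root_average k f z) \<and>
    sq_integrable (\<lambda>z. if k = 0 then 0 else root_average k g z) \<and>
    (AE z in torus. (if k = 0 then 0 else root_average k f z) = (if k = 0 then 0 else root_average k g z))"
    by (cases "k = 0") (simp_all add: sq_integrable_root_average AE_root_average,
        simp add: sq_integrable_def)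
qed

abbreviation "powi_op k \<equiv> comp_op (\<lambda>z i. z i powi (- int k))"

lemma haar_preserving_powi_neg: "k > 0 \<Longrightarrow> haar_preserving (\<lambda>z i. z i powi (- int k))"
  by (rule haar_preserving_powi) simp

text \<open>The right-hand side is the projection onto the vectors invariant under the kernel.
  Linearity, norm bound and values on the basis of the root average are all derived from this
  formula by cancelling the isometry \<open>powi_op k\<close>.\<close>

lemma powi_op_root_average_op:
  fixes x :: "'n::finite L2_torus"
  assumes k: "k > 0"
  shows "powi_op k (root_average_op k x) =
    scaleC (1 / of_nat (card (unity_vecs k :: ('n \<Rightarrow> complex) set)))
      (\<Sum>u\<in>unity_vecs k. comp_op (\<lambda>z i. u i * z i) x)"
proof -
  let ?c = "1 / of_nat (card (unity_vecs k :: ('n \<Rightarrow> complex) set)) :: complex"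
  obtain f where f: "sq_integrable f" "x = abs_L2_torus f"
    by (rule L2_torus_cases)
  have rot: "sq_integrable (\<lambda>z. f (\<lambda>i. u i * z i))" if "u \<in> unity_vecs k" for u
    using haar_preserving_unity_vec[OF k that] f
    by (simp add: sq_integrable_haar_preserving_iff[where g = "\<lambda>z i. u i * z i"] sq_integrable_measurable)
  have sums: "sq_integrable (\<lambda>z. \<Sum>u\<in>unity_vecs k. f (\<lambda>i. u i * z i)) \<and>
      (\<Sum>u\<in>unity_vecs k. abs_L2_torus (\<lambda>z. f (\<lambda>i. u i * z i))) =
      abs_L2_torus (\<lambda>z. \<Sum>u\<in>unity_vecs k. f (\<lambda>i. u i * z i))"
    by (intro sum_abs finite_unity_vecs k rot)
  have "(\<Sum>u\<in>unity_vecs k. comp_op (\<lambda>z i. u i * z i) x) =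
      (\<Sum>u\<in>unity_vecs k. abs_L2_torus (\<lambda>z. f (\<lambda>i. u i * z i)))"
    unfolding f(2) by (intro sum.cong refl comp_op_abs haar_preserving_unity_vec[OF k] f)
  also have "\<dots> = abs_L2_torus (\<lambda>z. \<Sum>u\<in>unity_vecs k. f (\<lambda>i. u i * z i))"
    using sums by simp
  finally have "scaleC ?c (\<Sum>u\<in>unity_vecs k. comp_op (\<lambda>z i. u i * z i) x) =
      abs_L2_torus (\<lambda>z. ?c * (\<Sum>u\<in>unity_vecs k. f (\<lambda>i. u i * z i)))"
    using sums by (simp add: scaleC_abs)
  moreover have "powi_op k (root_average_op k x) = abs_L2_torus (\<lambda>z. root_average k f (\<lambda>i. z i powi (- int k)))"
    using k f sq_integrable_root_average[OF f(1) k]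
    by (simp add: root_average_op.abs_eq comp_op_abs haar_preserving_powi_neg)
  moreover have "abs_L2_torus (\<lambda>z. root_average k f (\<lambda>i. z i powi (- int k))) =
      abs_L2_torus (\<lambda>z. ?c * (\<Sum>u\<in>unity_vecs k. f (\<lambda>i. u i * z i)))"
  proof (subst abs_L2_torus_eq_iff)
    show "AE z in torus. root_average k f (\<lambda>i. z i powi (- int k)) =
        ?c * (\<Sum>u\<in>unity_vecs k. f (\<lambda>i. u i * z i))"
      by (rule AE_I2) (simp add: root_average_powi)
    show "sq_integrable (\<lambda>z. ?c * (\<Sum>u\<in>unity_vecs k. f (\<lambda>i. u i * z i)))"
      using sums by (intro sq_integrable_cmult) simp
    show "sq_integrable (\<lambda>z. root_average k f (\<lambda>i. z i powi (- int k)))"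
      using sq_integrable_root_average[OF f(1) k] k
      by (simp add: sq_integrable_haar_preserving_iff[OF haar_preserving_powi_neg] sq_integrable_measurable)
  qed
  ultimately show ?thesis by simp
qed

lemma scaleC_add: "scaleC c (x + y) = scaleC c x + scaleC c y"
  by (rule linear_add[OF bounded_linear.linear[OF bounded_linear_scaleC]])

lemma scaleC_sum: "scaleC c (\<Sum>a\<in>A. f a) = (\<Sum>a\<in>A. scaleC c (f a))"
  by (rule linear_sum[OF bounded_linear.linear[OF bounded_linear_scaleC]])

lemma scaleC_scaleC: "scaleC c (scaleC d x) = scaleC (c * d) x"
  by transfer (simp add: mult.assoc sq_integrable_cmult)

lemma scaleC_1 [simp]: "scaleC 1 x = x"
  by (rule L2_torus_cases[of x]) (simp add: scaleC_abs)

lemma scaleC_0 [simp]: "scaleC 0 x = 0"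
  using norm_scaleC[of 0 x] by simp

lemma sum_scaleC_left: "(\<Sum>a\<in>A. scaleC (f a) x) = scaleC (\<Sum>a\<in>A. f a) x"
proof (induction A rule: infinite_finite_induct)
  case (insert a A)
  have "scaleC c x + scaleC d x = scaleC (c + d) x" for c d
    by transfer (simp add: distrib_right sq_integrable_add sq_integrable_cmult)
  with insert show ?case by simp
qed simp_all

lemma bounded_clinear_root_average_op:
  assumes k: "k > 0"
  shows "bounded_clinear (root_average_op k :: 'n::finite L2_torus \<Rightarrow> 'n L2_torus)"
proof (rule bounded_clinearI)
  fix x y :: "'n L2_torus" and c
  note W = bounded_clinear_comp_op[OF haar_preserving_powi_neg[OF k]]
  note R = bounded_clinear_comp_op[OF haar_preserving_unity_vec[OF k]]
  note eq = powi_op_root_average_op[OF k]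
  have "powi_op k (root_average_op k (x + y)) = powi_op k (root_average_op k x + root_average_op k y)"
    unfolding bounded_clinear_add[OF W] eq
    by (simp add: bounded_clinear_add[OF R] sum.distrib scaleC_add)
  then show "root_average_op k (x + y) = root_average_op k x + root_average_op k y"
    unfolding comp_op_eq_iff[OF haar_preserving_powi_neg[OF k]] .
  have "powi_op k (root_average_op k (scaleC c x)) = powi_op k (scaleC c (root_average_op k x))"
    unfolding bounded_clinear_scaleC[OF W] eq
    by (simp add: bounded_clinear_scaleC[OF R] scaleC_scaleC mult.commute flip: scaleC_sum)
  then show "root_average_op k (scaleC c x) = scaleC c (root_average_op k x)"
    unfolding comp_op_eq_iff[OF haar_preserving_powi_neg[OF k]] .
  \<comment> \<open>An average of isometries is a contraction.\<close>
  have "norm (\<Sum>u\<in>unity_vecs k. comp_op (\<lambda>z i. u i * z i) x) \<le> (\<Sum>u\<in>(unity_vecs k :: ('n \<Rightarrow> complex) set). norm x)"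
    by (intro sum_norm_le eq_refl norm_comp_op haar_preserving_unity_vec[OF k])
  then have "norm (powi_op k (root_average_op k x)) \<le> norm x"
    using card_unity_vecs[OF k, where 'n = 'n]
    by (simp add: eq norm_scaleC norm_divide field_simps)
  then show "norm (root_average_op k x) \<le> norm x * 1"
    by (simp add: norm_comp_op[OF haar_preserving_powi_neg[OF k]])
qed

text \<open>Rotation by \<open>u\<close> multiplies the basis vector by
  \<open>character m u\<close>, and the average of these numbers is 1 or 0 according to
  divisibility.\<close>

lemma root_average_op_monom:
  assumes k: "k > 0"
  shows "root_average_op k (monom_e m) =
    (if \<forall>i. int k dvd m i then monom_e (\<lambda>i. - (m i div int k)) else 0)"
proof -
  let ?n = "of_nat (card (unity_vecs k :: ('a \<Rightarrow> complex) set)) :: complex"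
  have "powi_op k (root_average_op k (monom_e m)) =
      scaleC (1 / ?n) (\<Sum>u\<in>unity_vecs k. scaleC (character m u) (monom_e m))"
    unfolding powi_op_root_average_op[OF k]
    using unity_vecs_subset[OF k] by (intro arg_cong[where f = "scaleC _"] sum.cong comp_op_rotation_monom) auto
  also have "\<dots> = scaleC (if \<forall>i. int k dvd m i then 1 else 0) (monom_e m)"
    using card_unity_vecs[OF k, where 'n = 'a]
    by (simp add: sum_scaleC_left scaleC_scaleC sum_character_unity_vecs[OF k])
  also have "\<dots> = powi_op k (if \<forall>i. int k dvd m i then monom_e (\<lambda>i. - (m i div int k)) else 0)"
  proof (cases "\<forall>i. int k dvd m i")
    case True
    then show ?thesis
      using k by (simp add: comp_op_powi_monom)
  next
    case False
    have "powi_op k 0 = (0 :: 'a L2_torus)"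
      using norm_comp_op[OF haar_preserving_powi_neg[OF k], of 0] by simp
    with False show ?thesis by auto
  qed
  finally show ?thesis
    unfolding comp_op_eq_iff[OF haar_preserving_powi_neg[OF k]] .
qed

text \<open>Settles existence and uniqueness in the definite description: the root average has the
  prescribed values, and density leaves no other bounded complex-linear operator with them.\<close>

lemma V_op_eq:
  assumes k: "k > 0"
  shows "V_op k = (root_average_op k :: 'n::finite L2_torus \<Rightarrow> 'n L2_torus)"
  unfolding V_op_def
proof (rule the_equality)
  fix V :: "'n L2_torus \<Rightarrow> 'n L2_torus"
  assume "bounded_clinear V \<and> (\<forall>m. V (monom_e m) =
    (if \<forall>i. int k dvd m i then monom_e (\<lambda>i. - (m i div int k)) else 0))"
  then show "V = root_average_op k"
    by (intro bounded_clinear_eqI bounded_clinear_root_average_op k) (simp_all add: root_average_op_monom[OF k])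
qed (simp add: bounded_clinear_root_average_op root_average_op_monom k)

lemma cinner_sum_right: "cinner x (\<Sum>a\<in>A. f a) = (\<Sum>a\<in>A. cinner x (f a))"
proof (induction A rule: infinite_finite_induct)
  case (insert a A)
  then show ?case by (simp add: cinner_add_right)
qed (use cinner_scaleC_right[of x 0 0] in simp_all)

text \<open>\<open>powi_op k x\<close> is fixed by the rotations of the kernel, so replacing
  \<open>y\<close> by its average over them leaves the inner product unchanged. This average is
  \<open>powi_op k (V_op k y)\<close>, and the isometry can be cancelled.\<close>

lemma cinner_powi_op_left:
  fixes x y :: "'n::finite L2_torus"
  assumes k: "k > 0"
  shows "cinner (powi_op k x) y = cinner x (V_op k y)"
proof -
  let ?U = "unity_vecs k :: ('n \<Rightarrow> complex) set"
  have "cinner (powi_op k x) (comp_op (\<lambda>z i. u i * z i) y) = cinner (powi_op k x) y" if u: "u \<in> ?U" for u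
  proof -
    have eq: "(\<lambda>z i. (u i * z i) powi (- int k)) = (\<lambda>z i. z i powi (- int k))"
      using u by (simp add: unity_vecs_def power_mult_distrib power_int_minus)
    have "comp_op (\<lambda>z i. u i * z i) (powi_op k x) = powi_op k x"
      using comp_op_comp_op[OF haar_preserving_unity_vec[OF k u] haar_preserving_powi_neg[OF k], of x]
        haar_preserving_powi_neg[OF k] by (simp add: eq)
    then show ?thesis
      using cinner_comp_op[OF haar_preserving_unity_vec[OF k u], of "powi_op k x" y] by simp
  qed
  then have "cinner (powi_op k x) (powi_op k (root_average_op k y)) = cinner (powi_op k x) y"
    using card_unity_vecs[OF k, where 'n = 'n]
    by (simp add: powi_op_root_average_op[OF k] cinner_scaleC_right cinner_sum_right)
  then show ?thesis
    by (simp add: cinner_comp_op[OF haar_preserving_powi_neg[OF k]] V_op_eq[OF k])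
qed

section \<open>Multiplication operators\<close>

lemma mult_op_abs:
  assumes "\<phi> \<in> L_infinity" "sq_integrable f"
  shows "sq_integrable (\<lambda>z. \<phi> z * f z)" and "mult_op \<phi> (abs_L2_torus f) = abs_L2_torus (\<lambda>z. \<phi> z * f z)"
proof -
  show "mult_op \<phi> (abs_L2_torus f) = abs_L2_torus (\<lambda>z. \<phi> z * f z)"
    using assms by (simp add: mult_op.abs_eq)
  obtain C where \<phi>: "\<phi> \<in> borel_measurable torus" "AE z in torus. cmod (\<phi> z) \<le> C"
    using assms by (auto simp: L_infinity_def)
  have f: "f \<in> borel_measurable torus" "integrable torus (\<lambda>z. C\<^sup>2 * (cmod (f z))\<^sup>2)"
    using assms by (simp_all add: sq_integrable_def)
  have "integrable torus (\<lambda>z. (cmod (\<phi> z * f z))\<^sup>2)"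
  proof (rule Bochner_Integration.integrable_bound[OF f(2)])
    show "AE z in torus. norm ((cmod (\<phi> z * f z))\<^sup>2) \<le> norm (C\<^sup>2 * (cmod (f z))\<^sup>2)"
      using \<phi>(2) by eventually_elim
        (auto simp: norm_mult power_mult_distrib intro!: mult_right_mono power_mono)
  qed (use \<phi>(1) f(1) in measurable)
  then show "sq_integrable (\<lambda>z. \<phi> z * f z)"
    using \<phi>(1) f(1) by (simp add: sq_integrable_def)
qed

lemma bounded_clinear_mult_op:
  fixes \<phi> :: "('n::finite \<Rightarrow> complex) \<Rightarrow> complex"
  assumes \<phi>: "\<phi> \<in> L_infinity"
  shows "bounded_clinear (mult_op \<phi>)"
proof -
  obtain C where C: "AE z in torus. cmod (\<phi> z) \<le> C"
    using assms by (auto simp: L_infinity_def)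
  show ?thesis
  proof (rule bounded_clinearI)
    fix x y :: "'n L2_torus" and c
    obtain f g where f: "sq_integrable f" "x = abs_L2_torus f" and g: "sq_integrable g" "y = abs_L2_torus g"
      by (metis L2_torus_cases)
    note sq = mult_op_abs(1)[OF \<phi> f(1)] mult_op_abs(1)[OF \<phi> g(1)]
    show "mult_op \<phi> (x + y) = mult_op \<phi> x + mult_op \<phi> y"
      using f g sq \<phi> by (simp add: plus_abs mult_op_abs sq_integrable_add distrib_left)
    show "mult_op \<phi> (scaleC c x) = scaleC c (mult_op \<phi> x)"
      using f sq \<phi> by (simp add: scaleC_abs mult_op_abs sq_integrable_cmult mult.left_commute)
    have "(LINT z|torus. (cmod (\<phi> z * f z))\<^sup>2) \<le> (LINT z|torus. C\<^sup>2 * (cmod (f z))\<^sup>2)"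
    proof (rule integral_mono_AE)
      show "AE z in torus. (cmod (\<phi> z * f z))\<^sup>2 \<le> C\<^sup>2 * (cmod (f z))\<^sup>2"
        using C by eventually_elim
          (auto simp: norm_mult power_mult_distrib intro!: mult_right_mono power_mono)
    qed (use sq f in \<open>simp_all add: sq_integrable_def\<close>)
    then have "norm (mult_op \<phi> x) \<le> sqrt (C\<^sup>2 * (LINT z|torus. (cmod (f z))\<^sup>2))"
      using f sq \<phi> by (simp add: mult_op_abs norm_abs)
    then show "norm (mult_op \<phi> x) \<le> norm x * \<bar>C\<bar>"
      using f by (simp add: norm_abs real_sqrt_mult mult.commute)
  qed
qed

section \<open>Multiplication by characters and adjoints\<close>

lemma character_in_L_infinity: "character m \<in> L_infinity"
proof -
  have "AE z in torus. cmod (character m z) \<le> 1"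
    by (rule AE_I2) (simp add: norm_character)
  then show ?thesis
    by (auto simp: L_infinity_def)
qed

lemma mult_op_character_monom:
  "mult_op (character m) (monom_e l) = monom_e (\<lambda>i. m i + l i)"
proof -
  have "AE z in torus. character m z * character l z = character (\<lambda>i. m i + l i) z"
    by (rule AE_I2) (simp add: character_add)
  then show ?thesis
    by (simp add: monom_e_abs mult_op_abs character_in_L_infinity sq_integrable_character
        abs_L2_torus_eq_iff)
qed

lemma cinner_mult_op_character:
  "cinner (mult_op (character m) x) y = cinner x (mult_op (character (\<lambda>i. - m i)) y)"
proof -
  obtain f g where f: "sq_integrable f" "x = abs_L2_torus f" and g: "sq_integrable g" "y = abs_L2_torus g"
    by (metis L2_torus_cases)
  have "(LINT z|torus. character m z * f z * cnj (g z)) =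
      (LINT z|torus. f z * cnj (character (\<lambda>i. - m i) z * g z))"
  proof (rule Bochner_Integration.integral_cong)
    fix z :: "'a \<Rightarrow> complex" assume z: "z \<in> space torus"
    show "character m z * f z * cnj (g z) = f z * cnj (character (\<lambda>i. - m i) z * g z)"
      using cnj_character[OF z, of "\<lambda>i. - m i"] by (simp add: mult_ac)
  qed simp
  then show ?thesis
    using f g by (simp add: mult_op_abs character_in_L_infinity cinner_abs)
qed

lemma cinner_V_op_left:
  "k > 0 \<Longrightarrow> cinner (V_op k x) y = cinner x (powi_op k y)"
  by (subst (1 2) cinner_commute) (simp add: cinner_powi_op_left)

lemma bounded_clinear_sum_op:
  assumes "finite A" "\<And>a. a \<in> A \<Longrightarrow> bounded_clinear (F a)"
  shows "bounded_clinear (\<lambda>x. \<Sum>a\<in>A. F a x)"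
proof -
  have "bounded_linear (\<lambda>x. \<Sum>a\<in>A. F a x)"
    using assms by (intro bounded_linear_sum) (simp add: bounded_clinear_def)
  moreover have "(\<Sum>a\<in>A. F a (scaleC c x)) = scaleC c (\<Sum>a\<in>A. F a x)" for c x
    using assms by (auto simp: bounded_clinear_scaleC scaleC_sum intro!: sum.cong)
  ultimately show ?thesis
    by (simp add: bounded_clinear_def)
qed

text \<open>By density, \<open>T x\<close> and \<open>\<phi> * x\<close> have the same inner product with every bounded function.
  If \<open>C\<close> bounds \<open>T\<close>, testing this with the indicator of \<open>A = {C < \<bar>\<phi>\<bar>}\<close> and the sign of
  \<open>\<phi>\<close> on \<open>A\<close> shows that \<open>A\<close> is a null set.\<close>

lemma mult_op_of_monom:
  fixes \<phi> :: "('n::finite \<Rightarrow> complex) \<Rightarrow> complex"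
  assumes T: "bounded_clinear T" and \<phi>: "sq_integrable \<phi>"
    and T_monom: "\<And>m. T (monom_e m) = abs_L2_torus (\<lambda>z. character m z * \<phi> z)"
  shows "\<phi> \<in> L_infinity" and "T = mult_op \<phi>"
proof -
  have T_lin: "bounded_linear T"
    using T by (simp add: bounded_clinear_def)
  then obtain C where C: "\<And>x. norm (T x) \<le> norm x * C" "C > 0"
    using bounded_linear.pos_bounded by blast
  have [measurable]: "\<phi> \<in> borel_measurable torus"
    using \<phi> by (simp add: sq_integrable_def)
  have [measurable]: "cnj \<in> borel_measurable borel"
    by (intro borel_measurable_continuous_onI continuous_intros)
  interpret prob_space "torus :: ('n \<Rightarrow> complex) measure" by (rule prob_space_torus)
  define A where "A = {z \<in> space torus. C < cmod (\<phi> z)}"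
  have A [measurable]: "A \<in> sets torus"
    unfolding A_def by measurable
  define g where "g z = indicator A z * (\<phi> z / complex_of_real (cmod (\<phi> z)))" for z
  \<comment> \<open>The adjoint of multiplication by \<phi>, applied to \<open>g\<close>. Although
    \<phi> is not yet known to be bounded, this is square integrable because
    \<open>cmod (g z) \<le> 1\<close>.\<close>
  define g' where "g' z = cnj (\<phi> z) * g z" for z
  have [measurable]: "g \<in> borel_measurable torus"
    unfolding g_def by measurable
  have [measurable]: "g' \<in> borel_measurable torus"
    unfolding g'_def by measurable
  have g_le: "cmod (g z) \<le> indicator A z" for z
    by (simp add: g_def norm_mult norm_divide indicator_def)
  have g_le_1: "cmod (g z) \<le> 1" for z
    using g_le[of z] by (cases "z \<in> A") simp_all
  have g: "sq_integrable g"
    by (rule sq_integrable_bounded[of _ 1]) (simp_all add: g_le_1)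
  have g': "sq_integrable g'"
  proof -
    have "integrable torus (\<lambda>z. (cmod (g' z))\<^sup>2)"
    proof (rule Bochner_Integration.integrable_bound)
      show "integrable torus (\<lambda>z. (cmod (\<phi> z))\<^sup>2)"
        using \<phi> by (simp add: sq_integrable_def)
      show "AE z in torus. norm ((cmod (g' z))\<^sup>2) \<le> norm ((cmod (\<phi> z))\<^sup>2)"
      proof (rule AE_I2)
        fix z
        have "cmod (g' z) \<le> cmod (\<phi> z) * 1"
          unfolding g'_def norm_mult complex_mod_cnj
          by (rule mult_left_mono[OF g_le_1]) simp
        then show "norm ((cmod (g' z))\<^sup>2) \<le> norm ((cmod (\<phi> z))\<^sup>2)"
          by (simp add: power_mono)
      qed
    qed measurable
    then show ?thesis
      by (simp add: sq_integrable_def)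
  qed
  have duality: "cinner (T x) (abs_L2_torus g) = cinner x (abs_L2_torus g')" for x
  proof -
    have "x \<in> {x. cinner (T x) (abs_L2_torus g) = cinner x (abs_L2_torus g')}"
    proof (rule L2_torus_dense)
      show "closed {x. cinner (T x) (abs_L2_torus g) = cinner x (abs_L2_torus g')}"
        by (intro closed_Collect_eq linear_continuous_on bounded_linear_cinner_left
            bounded_linear_compose[OF bounded_linear_cinner_left T_lin])
      show "monom_e m \<in> {x. cinner (T x) (abs_L2_torus g) = cinner x (abs_L2_torus g')}" for m
        unfolding mem_Collect_eq T_monom unfolding monom_e_abs
        using g g' \<phi> by (simp add: cinner_abs sq_integrable_character
            mult_op_abs(1)[OF character_in_L_infinity] g'_def mult.assoc)
    qed (simp_all add: bounded_clinear_add[OF T] bounded_clinear_scaleC[OF T]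
        cinner_add_left cinner_scaleC_left)
    then show ?thesis by simp
  qed
  have ind: "sq_integrable (indicator A)"
    by (rule sq_integrable_bounded[of _ 1]) (auto simp: indicator_def)
  have int_A: "integrable torus (indicat_real A)"
    by (rule integrable_const_bound[of _ 1]) (simp_all add: indicator_def)
  have norm_le: "norm (abs_L2_torus h) \<le> sqrt (prob A)"
    if "sq_integrable h" "\<And>z. cmod (h z) \<le> indicator A z" for h
  proof -
    have "(LINT z|torus. (cmod (h z))\<^sup>2) \<le> (LINT z|torus. indicat_real A z)"
    proof (rule integral_mono)
      show "(cmod (h z))\<^sup>2 \<le> indicat_real A z" for z
        using that(2)[of z] by (auto simp: indicator_def abs_square_le_1 split: if_splits)
    qed (use that(1) int_A in \<open>simp_all add: sq_integrable_def\<close>)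
    then show ?thesis
      using sets.sets_into_space[OF A] by (simp add: norm_abs that(1) Int_absorb2)
  qed
  have "cinner (abs_L2_torus (indicator A)) (abs_L2_torus g') =
      (LINT z|torus. complex_of_real (indicator A z * cmod (\<phi> z)))"
    unfolding cinner_abs[OF ind g']
  proof (rule Bochner_Integration.integral_cong)
    fix z
    have "\<phi> z * cnj (\<phi> z) / complex_of_real (cmod (\<phi> z)) = complex_of_real (cmod (\<phi> z))"
      by (simp add: complex_norm_square[symmetric] power2_eq_square)
    then show "indicator A z * cnj (g' z) = complex_of_real (indicator A z * cmod (\<phi> z))"
      by (simp add: g'_def g_def indicator_def)
  qed simp
  also have "\<dots> = complex_of_real (LINT z|torus. indicator A z * cmod (\<phi> z))"
    by (rule integral_complex_of_real)
  finally have "(LINT z|torus. indicator A z * cmod (\<phi> z)) =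
      Re (cinner (T (abs_L2_torus (indicator A))) (abs_L2_torus g))"
    by (simp add: duality)
  also have "\<dots> \<le> norm (T (abs_L2_torus (indicator A))) * norm (abs_L2_torus g)"
    by (rule order_trans[OF complex_Re_le_cmod norm_cinner_le])
  \<comment> \<open>Both the indicator of \<open>A\<close> and \<open>g\<close> have norm at most
    \<open>sqrt (prob A)\<close>, which turns the operator bound into exactly the integral of
    \<open>C\<close> over \<open>A\<close>.\<close>
  also have "\<dots> \<le> (sqrt (prob A) * C) * sqrt (prob A)"
    using C(2) by (intro mult_mono order_trans[OF C(1)] mult_right_mono norm_le ind g g_le)
      (auto simp: indicator_def)
  also have "\<dots> = (LINT z|torus. indicator A z * C)"
    using sets.sets_into_space[OF A] by (simp add: Int_absorb2)
  finally have le: "(LINT z|torus. indicator A z * cmod (\<phi> z)) \<le> (LINT z|torus. indicator A z * C)" .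
  have int: "integrable torus (\<lambda>z. indicator A z * cmod (\<phi> z))" "integrable torus (\<lambda>z. indicator A z * C)"
  proof -
    show "integrable torus (\<lambda>z. indicator A z * cmod (\<phi> z))"
    proof (rule Bochner_Integration.integrable_bound)
      show "integrable torus (\<lambda>z. 1 + (cmod (\<phi> z))\<^sup>2)"
        using \<phi> by (simp add: sq_integrable_def)
      show "AE z in torus. norm (indicator A z * cmod (\<phi> z)) \<le> norm (1 + (cmod (\<phi> z))\<^sup>2)"
      proof (rule AE_I2)
        fix z
        have "cmod (\<phi> z) \<le> 1 + (cmod (\<phi> z))\<^sup>2"
          using zero_le_power2[of "cmod (\<phi> z) - 1/2"] by (simp add: power2_eq_square algebra_simps)
        then show "norm (indicator A z * cmod (\<phi> z)) \<le> norm (1 + (cmod (\<phi> z))\<^sup>2)"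
          by (simp add: indicator_def)
      qed
    qed measurable
  qed (simp add: int_A)
  \<comment> \<open>On \<open>A\<close> the second factor is strictly positive by the choice of
    \<open>A\<close>, but the integral is at most 0 by \<open>le\<close>.\<close>
  have "AE z in torus. indicator A z * (cmod (\<phi> z) - C) = 0"
  proof (subst integral_nonneg_eq_0_iff_AE[symmetric])
    show "integrable torus (\<lambda>z. indicator A z * (cmod (\<phi> z) - C))"
      using int by (simp add: right_diff_distrib)
    show nonneg: "AE z in torus. 0 \<le> indicator A z * (cmod (\<phi> z) - C)"
      by (rule AE_I2) (simp add: A_def indicator_def)
    have "(LINT z|torus. indicator A z * (cmod (\<phi> z) - C)) \<ge> 0"
      using nonneg by (rule integral_nonneg_AE)
    then show "(LINT z|torus. indicator A z * (cmod (\<phi> z) - C)) = 0"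
      using le int by (simp add: right_diff_distrib)
  qed
  then have "AE z in torus. cmod (\<phi> z) \<le> C"
    by (rule AE_mp) (rule AE_I2, auto simp: A_def indicator_def not_less split: if_splits)
  then show L: "\<phi> \<in> L_infinity"
    by (auto simp: L_infinity_def)
  show "T = mult_op \<phi>"
  proof (rule bounded_clinear_eqI[OF T bounded_clinear_mult_op[OF L]])
    show "T (monom_e m) = mult_op \<phi> (monom_e m)" for m
      unfolding T_monom unfolding monom_e_abs
      by (simp add: mult_op_abs L sq_integrable_character mult.commute)
  qed
qed

section \<open>Slant Hankel matrices\<close>

text \<open>Representatives of the integer vectors modulo \<open>k\<close>; they index the frequency
  classes separated in \<open>laurent_op\<close>.\<close>

definition residue_vecs :: "nat \<Rightarrow> ('n::finite \<Rightarrow> int) set" where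
  "residue_vecs k = {r. \<forall>i. r i \<in> {0..<int k}}"

lemma finite_residue_vecs: "finite (residue_vecs k :: ('n::finite \<Rightarrow> int) set)"
proof -
  have "finite (PiE (UNIV :: 'n set) (\<lambda>_. {0..<int k}))"
    by (intro finite_PiE) auto
  also have "PiE (UNIV :: 'n set) (\<lambda>_. {0..<int k}) = residue_vecs k"
    by (auto simp: residue_vecs_def PiE_def Pi_def)
  finally show ?thesis .
qed

lemma ex1_residue_vec:
  assumes "k > 0"
  shows "\<exists>!r\<in>residue_vecs k. \<forall>i. int k dvd r i + l i"
proof -
  have *: "int k dvd r + l \<longleftrightarrow> r = (- l) mod int k" if "r \<in> {0..<int k}" for r l
    using that mod_eq_dvd_iff[of r "int k" "- l"] by simp
  show ?thesis
  proof (rule ex1I)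
    show "(\<lambda>i. (- l i) mod int k) \<in> residue_vecs k \<and> (\<forall>i. int k dvd (- l i) mod int k + l i)"
      using assms by (simp add: residue_vecs_def *)
    show "r = (\<lambda>i. (- l i) mod int k)" if "r \<in> residue_vecs k \<and> (\<forall>i. int k dvd r i + l i)" for r
    proof
      show "r i = (- l i) mod int k" for i
        using that *[of "r i" "l i"] by (simp add: residue_vecs_def)
    qed
  qed
qed

text \<open>For \<open>S = V_k M_phi\<close> the summand of \<open>r\<close> is the part of
  \<open>M_phi\<close> whose output frequencies are congruent to \<open>- r\<close> modulo
  \<open>k\<close>. Multiplication operators have Laurent matrices: the entry in row
  \<open>l\<close>, column \<open>m\<close> depends on \<open>l - m\<close> only.\<close>

definition laurent_op :: "nat \<Rightarrow> ('n::finite L2_torus \<Rightarrow> 'n L2_torus) \<Rightarrow> 'n L2_torus \<Rightarrow> 'n L2_torus" where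
  "laurent_op k S x = (\<Sum>r\<in>residue_vecs k.
     mult_op (character (\<lambda>i. - r i)) (powi_op k (S (mult_op (character r) x))))"

lemma bounded_clinear_laurent_op:
  assumes "k > 0" "bounded_clinear S"
  shows "bounded_clinear (laurent_op k S)"
proof -
  note M = bounded_clinear_mult_op[OF character_in_L_infinity]
    and W = bounded_clinear_comp_op[OF haar_preserving_powi_neg[OF assms(1)]]
  have "bounded_clinear (\<lambda>x. mult_op (character (\<lambda>i. - r i)) (powi_op k (S (mult_op (character r) x))))" for r
    by (rule bounded_clinear_compose[OF M bounded_clinear_compose[OF W bounded_clinear_compose[OF assms(2) M]]])
  then show ?thesis
    unfolding laurent_op_def[abs_def] by (rule bounded_clinear_sum_op[OF finite_residue_vecs])
qed

lemma cinner_laurent_op: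
  fixes S :: "'n::finite L2_torus \<Rightarrow> 'n L2_torus"
  assumes k: "k > 0"
    and a: "\<And>p q. operator_matrix S p q = a (\<lambda>i. - int k * p i - q i)"
  shows "cinner (laurent_op k S (monom_e m)) (monom_e l) = a (\<lambda>i. l i - m i)"
proof -
  have "cinner (mult_op (character (\<lambda>i. - r i)) (powi_op k (S (mult_op (character r) (monom_e m)))))
      (monom_e l) = (if \<forall>i. int k dvd r i + l i then a (\<lambda>i. l i - m i) else 0)" for r
  proof -
    have "cinner (mult_op (character (\<lambda>i. - r i)) (powi_op k (S (mult_op (character r) (monom_e m)))))
      (monom_e l) = cinner (S (monom_e (\<lambda>i. r i + m i))) (V_op k (monom_e (\<lambda>i. r i + l i)))"
      by (simp add: cinner_mult_op_character mult_op_character_monom cinner_powi_op_left k)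
    also have "\<dots> = (if \<forall>i. int k dvd r i + l i then a (\<lambda>i. l i - m i) else 0)"
    proof (cases "\<forall>i. int k dvd r i + l i")
      case True
      \<comment> \<open>The row is \<open>p = - (r + l) / k\<close> and the column
        \<open>q = r + m\<close>, so the index \<open>- k * p - q\<close> of \<open>a\<close>
        becomes \<open>l - m\<close>, free of \<open>r\<close>.\<close>
      then have "cinner (S (monom_e (\<lambda>i. r i + m i))) (V_op k (monom_e (\<lambda>i. r i + l i))) =
          operator_matrix S (\<lambda>i. - ((r i + l i) div int k)) (\<lambda>i. r i + m i)"
        by (simp add: V_op_eq root_average_op_monom k operator_matrix_def)
      then show ?thesis
        using True by (simp add: a)
    next
      case False
      then show ?thesis
        using cinner_scaleC_right[of "S (monom_e (\<lambda>i. r i + m i))" 0 0]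
        by (auto simp: V_op_eq root_average_op_monom k)
    qed
    finally show ?thesis .
  qed
  then have "cinner (laurent_op k S (monom_e m)) (monom_e l) =
      (\<Sum>r\<in>residue_vecs k. if \<forall>i. int k dvd r i + l i then a (\<lambda>i. l i - m i) else 0)"
    unfolding laurent_op_def
    by (subst cinner_commute) (simp add: cinner_sum_right flip: cinner_commute)
  also obtain r where r: "r \<in> residue_vecs k" "\<And>r'. r' \<in> residue_vecs k \<Longrightarrow> (\<forall>i. int k dvd r' i + l i) \<longleftrightarrow> r' = r"
    using ex1_residue_vec[OF k, of l] by metis
  have "(\<Sum>r\<in>residue_vecs k. if \<forall>i. int k dvd r i + l i then a (\<lambda>i. l i - m i) else 0) =
      (\<Sum>r'\<in>residue_vecs k. if r' = r then a (\<lambda>i. l i - m i) else 0)"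
    using r by (intro sum.cong) auto
  also have "\<dots> = a (\<lambda>i. l i - m i)"
    using r by (simp add: finite_residue_vecs)
  finally show ?thesis .
qed

theorem theorem2p4:
  fixes k :: nat and S :: "'n::finite L2_torus \<Rightarrow> 'n L2_torus"
  assumes "k \<ge> 2" and "bounded_clinear S"
  shows "slant_hankel_operator k S \<longleftrightarrow> slant_hankel_matrix k (operator_matrix S)"
proof
  have k: "k > 0" using assms(1) by simp
  have powi_monom: "powi_op k (monom_e m) = monom_e (\<lambda>i. - int k * m i)" for m :: "'n \<Rightarrow> int"
    using k by (simp add: comp_op_powi_monom)
  {
    assume "slant_hankel_operator k S"
    then obtain \<phi> where \<phi>: "\<phi> \<in> L_infinity" and S: "S = V_op k \<circ> mult_op \<phi>"
      by (auto simp: slant_hankel_operator_def)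
    \<comment> \<open>The Fourier coefficient of \<phi> at \<open>l\<close>. Moving
      \<open>character q\<close> to the other side of the inner product shifts the index
      \<open>- k * p\<close> to \<open>- k * p - q\<close>.\<close>
    define a where "a l = (LINT z|torus. \<phi> z * cnj (character l z))" for l
    have "operator_matrix S p q = a (\<lambda>i. - int k * p i - q i)" for p q
    proof -
      have "operator_matrix S p q = cinner (mult_op \<phi> (monom_e q)) (monom_e (\<lambda>i. - int k * p i))"
        by (simp add: operator_matrix_def S cinner_V_op_left k powi_monom)
      also have "\<dots> = (LINT z|torus. \<phi> z * character q z * cnj (character (\<lambda>i. - int k * p i) z))"
        by (simp add: monom_e_abs mult_op_abs \<phi> sq_integrable_character cinner_abs)
      also have "\<dots> = a (\<lambda>i. - int k * p i - q i)"
        unfolding a_def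
      proof (rule Bochner_Integration.integral_cong)
        fix z :: "'n \<Rightarrow> complex" assume z: "z \<in> space torus"
        show "\<phi> z * character q z * cnj (character (\<lambda>i. - int k * p i) z) =
            \<phi> z * cnj (character (\<lambda>i. - int k * p i - q i) z)"
          using character_add[OF z, of q "\<lambda>i. int k * p i"] by (simp add: cnj_character z add.commute)
      qed simp
      finally show ?thesis .
    qed
    then show "slant_hankel_matrix k (operator_matrix S)"
      by (auto simp: slant_hankel_matrix_iff)
  }
  {
    assume "slant_hankel_matrix k (operator_matrix S)"
    then obtain a where a: "\<And>p q. operator_matrix S p q = a (\<lambda>i. - int k * p i - q i)"
      by (auto simp: slant_hankel_matrix_iff)
    let ?T = "laurent_op k S"
    note T = bounded_clinear_laurent_op[OF k assms(2)]
    note cinner_T = cinner_laurent_op[of k S a, OF k a]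
    obtain \<phi> where \<phi>: "sq_integrable \<phi>" "?T (monom_e (\<lambda>_. 0)) = abs_L2_torus \<phi>"
      by (rule L2_torus_cases)
    \<comment> \<open>Both sides have the coefficient \<open>a (\<lambda>i. l i - m i)\<close> at
      every \<open>l\<close>; on the right it is the coefficient of \<open>T 1\<close> at
      \<open>l - m\<close>.\<close>
    have "?T (monom_e m) = mult_op (character m) (?T (monom_e (\<lambda>_. 0)))" for m
      by (rule cinner_monom_eqI) (simp add: cinner_mult_op_character mult_op_character_monom cinner_T)
    then have "?T (monom_e m) = abs_L2_torus (\<lambda>z. character m z * \<phi> z)" for m
      by (simp add: \<phi> mult_op_abs character_in_L_infinity)
    note mult = mult_op_of_monom[OF T \<phi>(1) this]
    have "S = (\<lambda>x. V_op k (mult_op \<phi> x))"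
    proof (rule bounded_clinear_eqI[OF assms(2)])
      show "bounded_clinear (\<lambda>x. V_op k (mult_op \<phi> x))"
        unfolding V_op_eq[OF k]
        by (rule bounded_clinear_compose[OF bounded_clinear_root_average_op[OF k] bounded_clinear_mult_op[OF mult(1)]])
      show "S (monom_e m) = V_op k (mult_op \<phi> (monom_e m))" for m
      proof (rule cinner_monom_eqI)
        fix l
        \<comment> \<open>\<open>mult_op \<phi>\<close> is folded back into the Laurent operator,
          whose entry in row \<open>- k * l\<close>, column \<open>m\<close> is \<open>a\<close> at
          \<open>- k * l - m\<close>, as for \<open>S\<close>.\<close>
        show "cinner (S (monom_e m)) (monom_e l) = cinner (V_op k (mult_op \<phi> (monom_e m))) (monom_e l)"
          using a[of l m]
          by (simp add: cinner_V_op_left k powi_monom cinner_T operator_matrix_def flip: mult(2))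
      qed
    qed
    then show "slant_hankel_operator k S"
      using mult(1) by (auto simp: slant_hankel_operator_def comp_def)
  }
qed

end
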